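(* Bounding is equivalent to Suslin Bounding for $\Pi^{1}_{1}$ sets; that is, Bounding holds if and only if for every $\Pi^{1}_{1}$ set $A \subseteq \omega^{\omega}$ and every function $f \colon \omega_{1} \to A$ there is a tree $T$ on $\omega \times \omega_{1}$ such that $A = p[T]$ and $\{ \alpha < \omega_{1} : f(\alpha) \in p[T \restriction (\omega \times \alpha)]\}$ contains a club.
   Context: Given an ordinal $\gamma$, a function $f \colon \omega_{1} \to \mathrm{Ord}$ is a canonical function for $\gamma$ if the empty condition of $\mathcal{P}(\omega_{1})/NS_{\omega_{1}}$ forces $j(f)(\omega^{V}_{1}) = \gamma$, where $j$ is the generic elementary embedding. Bounding is the statement that every function from $\omega_{1}$ to $\omega_{1}$ is bounded on a club by a canonical function for an ordinal less than $\omega_{2}$. Reals are elements of $\omega^\omega$. For a tree $T$ on $\omega\times\kappa$, $p[T]$ is its projection (the set of $x\in\omega^\omega$ for which there is $y\in\kappa^\omega$ with $(x\restriction n,y\restriction n)\in T$ for all $n$), and $T\restriction(\omega\times\alpha)$ is the subtree of pairs whose second coordinate lies in $\alpha^{<\omega}$. *)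

theory Defs
  imports "HOL-Analysis.Analysis" "HOL-Library.Equipollence"
begin

section \<open>Ordinals\<close>

text \<open>
  HOL has no type of all ordinals. A well-ordered type plays the role of Ord, an ordinal being
  identified with the set \<open>{..<\<kappa>}\<close> of its predecessors. The only requirement is that the second
  uncountable cardinal belongs to the type; results are stated for every such type.
\<close>

class ordinal_universe = wellorder +
  assumes uncountable_successor_exists:
    "\<exists>(\<kappa> :: 'a) (\<mu> :: 'a). uncountable {..<\<kappa>} \<and> {..<\<kappa>} \<prec> {..<\<mu>}"

definition omega1 :: "'o::ordinal_universe" where
  "omega1 = (LEAST \<kappa>. uncountable {..<\<kappa>})"

definition omega2 :: "'o::ordinal_universe" where
  "omega2 = (LEAST \<kappa>. {..<(omega1 :: 'o)} \<prec> {..<\<kappa>})"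


section \<open>Clubs and the nonstationary ideal on \<open>\<omega>\<^sub>1\<close>\<close>

definition club :: "'o::ordinal_universe set \<Rightarrow> bool" where
  "club C \<longleftrightarrow> C \<subseteq> {..<omega1} \<and>
     (\<forall>\<alpha> < omega1. \<exists>\<beta>\<in>C. \<alpha> < \<beta>) \<and>
     (\<forall>\<delta> < omega1. {..<\<delta>} \<noteq> {} \<and> (\<forall>\<alpha><\<delta>. \<exists>\<beta>\<in>C. \<alpha> < \<beta> \<and> \<beta> < \<delta>) \<longrightarrow> \<delta> \<in> C)"

definition nonstationary :: "'o::ordinal_universe set \<Rightarrow> bool" where
  "nonstationary S \<longleftrightarrow> S \<subseteq> {..<omega1} \<and> (\<exists>C. club C \<and> S \<inter> C = {})"


section \<open>Forcing with \<open>\<P>(\<omega>\<^sub>1)/NS\<close>\<close>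

text \<open>
  A condition is the class of a stationary set; we work with representatives, preordered by
  inclusion modulo the nonstationary ideal. A sentence of the forcing language is represented by
  the set of conditions that force it, and the connectives are given by the recursive clauses of
  the definition of the forcing relation. Quantifiers range over ground-model sets.
\<close>

definition condition :: "'o::ordinal_universe set \<Rightarrow> bool" where
  "condition S \<longleftrightarrow> S \<subseteq> {..<omega1} \<and> \<not> nonstationary S"

definition stronger :: "'o::ordinal_universe set \<Rightarrow> 'o set \<Rightarrow> bool" where
  "stronger S T \<longleftrightarrow> condition S \<and> condition T \<and> nonstationary (S - T)"

type_synonym 'o sentence = "'o set \<Rightarrow> bool"

text \<open>\<open>X \<in> G\<close>, where \<open>G\<close> is the generic ultrafilter on the ground-model subsets of \<open>\<omega>\<^sub>1\<close>.\<close>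

definition f_generic :: "'o::ordinal_universe set \<Rightarrow> 'o sentence" where
  "f_generic X = (\<lambda>S. nonstationary (S - X))"

definition f_and :: "'o::ordinal_universe sentence \<Rightarrow> 'o sentence \<Rightarrow> 'o sentence" where
  "f_and \<phi> \<psi> = (\<lambda>S. \<phi> S \<and> \<psi> S)"

definition f_imp :: "'o::ordinal_universe sentence \<Rightarrow> 'o sentence \<Rightarrow> 'o sentence" where
  "f_imp \<phi> \<psi> = (\<lambda>S. \<forall>T. stronger T S \<and> \<phi> T \<longrightarrow> \<psi> T)"

definition f_ball :: "'b set \<Rightarrow> ('b \<Rightarrow> 'o::ordinal_universe sentence) \<Rightarrow> 'o sentence" where
  "f_ball A \<phi> = (\<lambda>S. \<forall>x\<in>A. \<phi> x S)"

definition f_bex :: "'b set \<Rightarrow> ('b \<Rightarrow> 'o::ordinal_universe sentence) \<Rightarrow> 'o sentence" where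
  "f_bex A \<phi> = (\<lambda>S. \<forall>T. stronger T S \<longrightarrow> (\<exists>U. stronger U T \<and> (\<exists>x\<in>A. \<phi> x U)))"

lemma f_ball_cong [fundef_cong]:
  "A = B \<Longrightarrow> (\<And>x. x \<in> B \<Longrightarrow> \<phi> x = \<psi> x) \<Longrightarrow> f_ball A \<phi> = f_ball B \<psi>"
  by (auto simp: f_ball_def)

lemma f_bex_cong [fundef_cong]:
  "A = B \<Longrightarrow> (\<And>x. x \<in> B \<Longrightarrow> \<phi> x = \<psi> x) \<Longrightarrow> f_bex A \<phi> = f_bex B \<psi>"
  by (simp add: f_bex_def)


section \<open>The generic ultrapower and canonical functions\<close>

text \<open>
  The ordinals of the generic ultrapower are the classes \<open>[g]\<close> of ground-model functions from
  \<open>\<omega>\<^sub>1\<close> to the ordinals. Functions are total on the type, but only their restrictions to \<open>\<omega>\<^sub>1\<close>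
  matter. The following sentence says \<open>[g] < [f]\<close>.
\<close>

definition ult_less :: "('o \<Rightarrow> 'o) \<Rightarrow> ('o \<Rightarrow> 'o) \<Rightarrow> 'o::ordinal_universe sentence" where
  "ult_less g f = f_generic {\<alpha>. \<alpha> < omega1 \<and> g \<alpha> < f \<alpha>}"

text \<open>
  The sentence \<open>[f] = \<gamma>\<close>, for an ordinal \<open>\<gamma>\<close> of the ground model. The well-founded part of the
  ultrapower is identified with its transitive collapse, so this says that the ultrapower elements
  below \<open>[f]\<close> are, after collapsing, exactly the \<open>\<beta> < \<gamma>\<close>.
\<close>

function ult_is_ord :: "('o \<Rightarrow> 'o) \<Rightarrow> 'o \<Rightarrow> 'o::ordinal_universe sentence" where
  "ult_is_ord f \<gamma> =
     f_and
       (f_ball UNIV (\<lambda>g. f_imp (ult_less g f) (f_bex {..<\<gamma>} (\<lambda>\<beta>. ult_is_ord g \<beta>))))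
       (f_ball {..<\<gamma>} (\<lambda>\<beta>. f_bex UNIV (\<lambda>g. f_and (ult_less g f) (ult_is_ord g \<beta>))))"
  by pat_completeness auto
termination
  by (relation "inv_image {(x, y). x < y} snd") (auto intro: wf_inv_image wf)

declare ult_is_ord.simps [simp del]

text \<open>
  The sentence \<open>j(f)(\<omega>\<^sub>1\<^sup>V) = \<gamma>\<close>. Since \<open>j(f)\<close> is the class of the constant function with value
  \<open>f\<close>, its domain consists of the classes of functions \<open>h : \<omega>\<^sub>1 \<rightarrow> \<omega>\<^sub>1\<close> and
  \<open>j(f)([h]) = [f \<circ> h]\<close>. So the sentence says that \<open>[f \<circ> h] = \<gamma>\<close> for some \<open>h\<close> with
  \<open>[h] = \<omega>\<^sub>1\<^sup>V\<close>.
\<close>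

definition j_at_omega1_is :: "('o \<Rightarrow> 'o) \<Rightarrow> 'o \<Rightarrow> 'o::ordinal_universe sentence" where
  "j_at_omega1_is f \<gamma> =
     f_bex ({..<omega1} \<rightarrow> {..<omega1})
       (\<lambda>h. f_and (ult_is_ord h omega1) (ult_is_ord (f \<circ> h) \<gamma>))"

text \<open>The weakest condition, called the empty condition, is the class of \<open>\<omega>\<^sub>1\<close>.\<close>

definition canonical_function :: "'o::ordinal_universe \<Rightarrow> ('o \<Rightarrow> 'o) \<Rightarrow> bool" where
  "canonical_function \<gamma> f \<longleftrightarrow> j_at_omega1_is f \<gamma> {..<omega1}"

definition Bounding :: "'o::ordinal_universe itself \<Rightarrow> bool" where
  "Bounding _ \<longleftrightarrow>
     (\<forall>F \<in> {..<omega1 :: 'o} \<rightarrow> {..<omega1}.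
        \<exists>\<gamma> < omega2. \<exists>f. canonical_function \<gamma> f \<and> (\<exists>C. club C \<and> (\<forall>\<alpha>\<in>C. F \<alpha> \<le> f \<alpha>)))"


section \<open>Trees and Suslin Bounding\<close>

text \<open>
  A node of a tree on \<open>\<omega> \<times> \<kappa>\<close> is a pair of finite sequences of the same length.
\<close>

definition tree_on :: "'o::ordinal_universe \<Rightarrow> (nat list \<times> 'o list) set \<Rightarrow> bool" where
  "tree_on \<kappa> T \<longleftrightarrow>
     (\<forall>(s, t) \<in> T. length s = length t \<and> set t \<subseteq> {..<\<kappa>} \<and> (\<forall>n. (take n s, take n t) \<in> T))"

definition seq_restrict :: "(nat \<Rightarrow> 'b) \<Rightarrow> nat \<Rightarrow> 'b list" where
  "seq_restrict x n = map x [0..<n]"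

definition tree_proj :: "(nat list \<times> 'o list) set \<Rightarrow> (nat \<Rightarrow> nat) set" where
  "tree_proj T = {x. \<exists>y. \<forall>n. (seq_restrict x n, seq_restrict y n) \<in> T}"

definition tree_restrict ::
    "(nat list \<times> 'o list) set \<Rightarrow> 'o::ordinal_universe \<Rightarrow> (nat list \<times> 'o list) set" where
  "tree_restrict T \<alpha> = {(s, t) \<in> T. set t \<subseteq> {..<\<alpha>}}"

definition Suslin_Bounding ::
    "'o::ordinal_universe itself \<Rightarrow> ((nat \<Rightarrow> nat) set \<Rightarrow> bool) \<Rightarrow> bool" where
  "Suslin_Bounding _ \<Gamma> \<longleftrightarrow>
     (\<forall>A. \<Gamma> A \<longrightarrow>
        (\<forall>f \<in> {..<omega1 :: 'o} \<rightarrow> A.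
           \<exists>T. tree_on (omega1 :: 'o) T \<and> A = tree_proj T \<and>
               (\<exists>C. club C \<and> C \<subseteq> {\<alpha>. \<alpha> < omega1 \<and> f \<alpha> \<in> tree_proj (tree_restrict T \<alpha>)})))"


section \<open>\<open>\<Pi>\<^sup>1\<^sub>1\<close> sets\<close>

text \<open>
  Formulas of second-order arithmetic without quantifiers over reals, in two real variables
  \<open>x\<close> and \<open>y\<close>; \<open>RealX t\<close> is the term \<open>x(t)\<close>, and \<open>RealY t\<close> is \<open>y(t)\<close>.
\<close>

datatype arith_term =
    NumVar nat
  | Zero
  | One
  | Plus arith_term arith_term
  | Times arith_term arith_term
  | RealX arith_term
  | RealY arith_term

datatype arith_formula =
    Equals arith_term arith_term
  | Less arith_term arith_term
  | Not arith_formula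
  | And arith_formula arith_formula
  | ExNum nat arith_formula

primrec arith_val :: "(nat \<Rightarrow> nat) \<Rightarrow> (nat \<Rightarrow> nat) \<Rightarrow> (nat \<Rightarrow> nat) \<Rightarrow> arith_term \<Rightarrow> nat" where
  "arith_val x y e (NumVar i) = e i"
| "arith_val x y e Zero = 0"
| "arith_val x y e One = 1"
| "arith_val x y e (Plus s t) = arith_val x y e s + arith_val x y e t"
| "arith_val x y e (Times s t) = arith_val x y e s * arith_val x y e t"
| "arith_val x y e (RealX t) = x (arith_val x y e t)"
| "arith_val x y e (RealY t) = y (arith_val x y e t)"

primrec arith_sat ::
    "(nat \<Rightarrow> nat) \<Rightarrow> (nat \<Rightarrow> nat) \<Rightarrow> (nat \<Rightarrow> nat) \<Rightarrow> arith_formula \<Rightarrow> bool" where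
  "arith_sat x y e (Equals s t) \<longleftrightarrow> arith_val x y e s = arith_val x y e t"
| "arith_sat x y e (Less s t) \<longleftrightarrow> arith_val x y e s < arith_val x y e t"
| "arith_sat x y e (Not \<phi>) \<longleftrightarrow> \<not> arith_sat x y e \<phi>"
| "arith_sat x y e (And \<phi> \<psi>) \<longleftrightarrow> arith_sat x y e \<phi> \<and> arith_sat x y e \<psi>"
| "arith_sat x y e (ExNum i \<phi>) \<longleftrightarrow> (\<exists>n. arith_sat x y (e(i := n)) \<phi>)"

text \<open>
  Lightface \<open>\<Pi>\<^sup>1\<^sub>1\<close>: definable without parameters by a universal real quantifier followed by an
  arithmetical formula. Free number variables, if any, are read as \<open>0\<close>.
\<close>

definition lightface_Pi11 :: "(nat \<Rightarrow> nat) set \<Rightarrow> bool" where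
  "lightface_Pi11 A \<longleftrightarrow> (\<exists>\<phi>. A = {x. \<forall>y. arith_sat x y (\<lambda>_. 0) \<phi>})"

text \<open>
  Boldface \<open>\<Pi>\<^sup>1\<^sub>1\<close>: the complement is a projection of a closed subset of the product of two copies
  of Baire space (\<open>nat \<Rightarrow> nat\<close> carries the product of the discrete topologies).
\<close>

definition boldface_Pi11 :: "(nat \<Rightarrow> nat) set \<Rightarrow> bool" where
  "boldface_Pi11 A \<longleftrightarrow>
     (\<exists>F :: ((nat \<Rightarrow> nat) \<times> (nat \<Rightarrow> nat)) set. closed F \<and> - A = fst ` F)"


section \<open>The class \<open>ordinal_universe\<close> is inhabited\<close>

typedef sample_ord = "UNIV :: nat set set set set" by simp

definition sample_ord_rel :: "sample_ord rel" where
  "sample_ord_rel = card_of UNIV"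

lemma sample_ord_rel:
  "Well_order sample_ord_rel" "Field sample_ord_rel = UNIV"
  "refl sample_ord_rel" "trans sample_ord_rel" "antisym sample_ord_rel"
  "total_on UNIV sample_ord_rel" "wf (sample_ord_rel - Id)"
proof -
  show w: "Well_order sample_ord_rel"
    unfolding sample_ord_rel_def by (rule card_of_Well_order)
  show f: "Field sample_ord_rel = UNIV"
    unfolding sample_ord_rel_def by (rule Field_card_of)
  from w show "refl sample_ord_rel" "trans sample_ord_rel" "antisym sample_ord_rel"
      "total_on UNIV sample_ord_rel" "wf (sample_ord_rel - Id)"
    unfolding f
    by (auto simp: well_order_on_def linear_order_on_def partial_order_on_def preorder_on_def)
qed

instantiation sample_ord :: linorder
begin
definition "x \<le> y \<longleftrightarrow> (x, y) \<in> sample_ord_rel"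
definition "x < y \<longleftrightarrow> (x, y) \<in> sample_ord_rel \<and> x \<noteq> (y :: sample_ord)"
instance
proof
  fix x y z :: sample_ord
  show "x < y \<longleftrightarrow> x \<le> y \<and> \<not> y \<le> x"
    using sample_ord_rel(3,5)
    by (auto simp: less_eq_sample_ord_def less_sample_ord_def dest: antisymD reflD)
  show "x \<le> x"
    using sample_ord_rel(3) by (auto simp: less_eq_sample_ord_def dest: reflD)
  show "x \<le> y \<Longrightarrow> y \<le> z \<Longrightarrow> x \<le> z"
    using sample_ord_rel(4) by (auto simp: less_eq_sample_ord_def dest: transD)
  show "x \<le> y \<Longrightarrow> y \<le> x \<Longrightarrow> x = y"
    using sample_ord_rel(5) by (auto simp: less_eq_sample_ord_def dest: antisymD)
  show "x \<le> y \<or> y \<le> x"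
    using sample_ord_rel(3,6) unfolding less_eq_sample_ord_def
    by (metis UNIV_I total_on_def reflD)
qed
end

instance sample_ord :: wellorder
proof
  fix P :: "sample_ord \<Rightarrow> bool" and a :: sample_ord
  assume step: "\<And>x. (\<And>y. y < x \<Longrightarrow> P y) \<Longrightarrow> P x"
  show "P a"
    using sample_ord_rel(7)
    by (induction a rule: wf_induct_rule) (auto intro: step simp: less_sample_ord_def)
qed

lemma sample_ord_segment:
  assumes "(card_of (UNIV :: 'b set), card_of (UNIV :: sample_ord set)) \<in> ordLess"
  obtains \<kappa> :: sample_ord where "(UNIV :: 'b set) \<approx> {..<\<kappa>}"
proof -
  obtain \<kappa> where
    "(card_of (UNIV :: 'b set), Restr sample_ord_rel (underS sample_ord_rel \<kappa>)) \<in> ordIso"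
    using assms unfolding ordLess_iff_ordIso_Restr[OF card_of_Well_order card_of_Well_order]
    by (auto simp: sample_ord_rel_def)
  then obtain h where
    h: "iso (card_of (UNIV :: 'b set)) (Restr sample_ord_rel (underS sample_ord_rel \<kappa>)) h"
    by (auto simp: ordIso_def)
  have "Field (Restr sample_ord_rel (underS sample_ord_rel \<kappa>)) = underS sample_ord_rel \<kappa>"
    using sample_ord_rel(1) by (simp add: Field_Restr_ofilter wo_rel.underS_ofilter wo_rel_def)
  also have "underS sample_ord_rel \<kappa> = {..<\<kappa>}"
    by (auto simp: underS_def less_sample_ord_def)
  finally have "bij_betw h UNIV {..<\<kappa>}"
    using h by (simp add: iso_def Field_card_of)
  then show ?thesis
    using that unfolding eqpoll_def by blast
qed

lemma lesspoll_UNIV_set: "(UNIV :: 'b set) \<prec> (UNIV :: 'b set set)"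
proof -
  have "inj_on (\<lambda>x. {x}) (UNIV :: 'b set)"
    by simp
  then have "(UNIV :: 'b set) \<lesssim> (UNIV :: 'b set set)"
    unfolding lepoll_def by blast
  moreover have "\<not> (UNIV :: 'b set) \<approx> (UNIV :: 'b set set)"
    using Cantors_theorem[of "UNIV :: 'b set"] by (auto simp: eqpoll_def bij_betw_def)
  ultimately show ?thesis
    by (simp add: lesspoll_def)
qed

instance sample_ord :: ordinal_universe
proof
  have "bij Rep_sample_ord"
    using type_definition.Rep_range[OF type_definition_sample_ord]
    by (simp add: bij_def inj_def Rep_sample_ord_inject)
  then have "(card_of (UNIV :: nat set set set set), card_of (UNIV :: sample_ord set)) \<in> ordIso"
    using card_of_ordIso ordIso_symmetric by blast
  then have big: "(card_of (UNIV :: nat set set set), card_of (UNIV :: sample_ord set)) \<in> ordLess"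
    using card_of_Pow[of "UNIV :: nat set set set"] ordLess_ordIso_trans by (metis Pow_UNIV)
  then have "(card_of (UNIV :: nat set set), card_of (UNIV :: sample_ord set)) \<in> ordLess"
    using card_of_Pow[of "UNIV :: nat set set"] ordLess_transitive by (metis Pow_UNIV)
  then obtain \<kappa> :: sample_ord where \<kappa>: "(UNIV :: nat set set) \<approx> {..<\<kappa>}"
    by (rule sample_ord_segment)
  obtain \<mu> :: sample_ord where \<mu>: "(UNIV :: nat set set set) \<approx> {..<\<mu>}"
    using big by (rule sample_ord_segment)
  have "\<not> (UNIV :: nat set set) \<lesssim> (UNIV :: nat set)"
    using lesspoll_UNIV_set[where 'b = nat] lepoll_antisym unfolding lesspoll_def by blast
  then have "uncountable (UNIV :: nat set set)"
    unfolding countable_def lepoll_def by blast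
  then have "uncountable {..<\<kappa>}"
    using \<kappa> countable_eqpoll by blast
  moreover have "{..<\<kappa>} \<prec> {..<\<mu>}"
    using \<kappa> \<mu> lesspoll_UNIV_set by (meson eqpoll_sym lesspoll_eq_trans eq_lesspoll_trans)
  ultimately show "\<exists>(\<kappa> :: sample_ord) (\<mu> :: sample_ord). uncountable {..<\<kappa>} \<and> {..<\<kappa>} \<prec> {..<\<mu>}"
    by blast
qed

end

theory Submission
  imports Defs
begin

text \<open>
  For \<open>\<gamma> < \<omega>\<^sub>2\<close>, fix an injection of \<open>\<gamma>\<close> into \<open>\<omega>\<^sub>1\<close> and let \<open>canon \<gamma> \<alpha>\<close> be the order type of the set of
  elements of \<open>\<gamma>\<close> with index below \<open>\<alpha>\<close>. By Fodor's lemma, the canonical functions for \<open>\<gamma>\<close> are exactly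
  those that agree with \<open>canon \<gamma>\<close> on a club, so Bounding says that every \<open>F : \<omega>\<^sub>1 \<rightarrow> \<omega>\<^sub>1\<close> is below some
  \<open>canon \<gamma>\<close> on a club.

  Given Bounding and a \<open>\<Pi>\<^sup>1\<^sub>1\<close> set \<open>A\<close>, membership in \<open>A\<close> is the wellfoundedness of a tree \<open>N x\<close> on \<open>\<nat>\<close>.
  Bound the ranks of the trees \<open>N (f \<alpha>)\<close> by \<open>canon \<gamma> \<alpha>\<close>. The Shoenfield tree whose branches are pairs of
  \<open>x\<close> and a ranking of \<open>N x\<close> in \<open>\<gamma>\<close>, transported to \<open>\<omega>\<^sub>1\<close> by the injection, projects to
  \<open>A\<close> and has a branch through \<open>f \<alpha>\<close> with ordinals below \<open>\<alpha>\<close> for club many \<open>\<alpha>\<close>.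

  Conversely, apply Suslin Bounding to the set of codes of wellfounded relations and to a function
  \<open>f\<close> such that \<open>f \<alpha>\<close> codes \<open>F \<alpha>\<close>. The Kunen-Martin tree of \<open>T\<close> is wellfounded and has a rank
  \<open>\<gamma> < \<omega>\<^sub>2\<close>. If \<open>f \<alpha>\<close> is in the projection of \<open>T\<close> restricted to \<open>\<alpha>\<close>, then \<open>F \<alpha>\<close> embeds into the set of
  ranks of nodes with entries below \<open>\<alpha>\<close>, and on a club these ranks have index below \<open>\<alpha>\<close>.
\<close>

section \<open>Order types\<close>

text \<open>
  The least ordinal into which \<open>B\<close> embeds, that is, its order type. This is meaningful only if some
  such ordinal exists in the type, for instance if \<open>B\<close> is bounded.
\<close>

definition otp :: "'a::wellorder set \<Rightarrow> 'a" where
  "otp B = (LEAST \<beta>. \<exists>h. strict_mono_on B h \<and> h ` B \<subseteq> {..<\<beta>})"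

lemma otp_le:
  assumes "strict_mono_on B h" "h ` B \<subseteq> {..<\<beta>}"
  shows "otp B \<le> \<beta>"
  unfolding otp_def using assms by (intro Least_le) blast

lemma otp_embedding:
  fixes B :: "'a::wellorder set"
  assumes "B \<subseteq> {..<\<gamma>}"
  obtains h where "strict_mono_on B h" "h ` B \<subseteq> {..<otp B}"
proof -
  have "\<exists>h. strict_mono_on B h \<and> h ` B \<subseteq> {..<\<gamma>}"
    using assms by (intro exI[of _ id]) (auto simp: strict_mono_on_def)
  then have "\<exists>h. strict_mono_on B h \<and> h ` B \<subseteq> {..<otp B}"
    unfolding otp_def by (rule LeastI)
  then show ?thesis
    using that by blast
qed

text \<open>An embedding of \<open>B\<close> into \<open>otp B\<close> sends the part of
  \<open>B\<close> below \<open>b\<close> below its value at \<open>b\<close>, which is itself less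
  than \<open>otp B\<close>.\<close>

lemma otp_initial_less:
  assumes "B \<subseteq> {..<\<gamma>}" "b \<in> B"
  shows "otp (B \<inter> {..<b}) < otp B"
proof -
  obtain h where h: "strict_mono_on B h" "h ` B \<subseteq> {..<otp B}"
    using assms(1) by (rule otp_embedding)
  have "otp (B \<inter> {..<b}) \<le> h b"
    using h(1) assms(2) by (intro otp_le[where h = h]) (auto simp: strict_mono_on_def)
  also have "h b < otp B"
    using h(2) assms(2) by blast
  finally show ?thesis .
qed

lemma otp_initial_strict_mono:
  assumes "B \<subseteq> {..<\<gamma>}"
  shows "strict_mono_on B (\<lambda>b. otp (B \<inter> {..<b}))"
proof (rule strict_mono_onI)
  fix a b assume ab: "a \<in> B" "b \<in> B" "a < b"
  have "otp ((B \<inter> {..<b}) \<inter> {..<a}) < otp (B \<inter> {..<b})"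
    using assms ab by (intro otp_initial_less[where \<gamma> = \<gamma>]) auto
  moreover have "(B \<inter> {..<b}) \<inter> {..<a} = B \<inter> {..<a}"
    using ab by auto
  ultimately show "otp (B \<inter> {..<a}) < otp (B \<inter> {..<b})"
    by simp
qed

text \<open>The order types of initial segments form the collapsing map of \<open>B\<close>. If it
  skipped \<open>\<delta>\<close>, it would embed either all of \<open>B\<close>, or the segment
  below the first point whose value exceeds \<open>\<delta>\<close>, into \<open>\<delta>\<close>;
  both contradict the choice of \<open>\<delta>\<close>.\<close>

lemma less_otp_imp_initial:
  assumes B: "B \<subseteq> {..<\<gamma>}" and \<delta>: "\<delta> < otp B"
  obtains b where "b \<in> B" "otp (B \<inter> {..<b}) = \<delta>"
proof (rule ccontr)
  let ?c = "\<lambda>b. otp (B \<inter> {..<b})"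
  assume "\<not> thesis"
  then have ne: "?c b \<noteq> \<delta>" if "b \<in> B" for b
    using that \<open>\<And>b. b \<in> B \<Longrightarrow> ?c b = \<delta> \<Longrightarrow> thesis\<close> by blast
  have mono: "strict_mono_on B ?c"
    using B by (rule otp_initial_strict_mono)
  have "\<exists>b. b \<in> B \<and> \<delta> < ?c b"
  proof (rule ccontr)
    assume "\<not> ?thesis"
    then have "?c ` B \<subseteq> {..<\<delta>}"
      using ne by (auto simp: not_less order_le_less)
    then show False
      using otp_le[OF mono, of \<delta>] \<delta> by simp
  qed
  then obtain b where b: "b \<in> B" "\<delta> < ?c b"
    and min: "\<And>a. a < b \<Longrightarrow> \<not> (a \<in> B \<and> \<delta> < ?c a)"
    using exists_least_iff[of "\<lambda>b. b \<in> B \<and> \<delta> < ?c b"] by blast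
  have "otp (B \<inter> {..<b}) \<le> \<delta>"
  proof (rule otp_le)
    show "strict_mono_on (B \<inter> {..<b}) ?c"
      using mono by (auto simp: strict_mono_on_def)
    show "?c ` (B \<inter> {..<b}) \<subseteq> {..<\<delta>}"
      using min ne by (force simp: not_less order_le_less)
  qed
  with b show False
    by simp
qed

lemma strict_mono_on_expansive:
  fixes h :: "'a::wellorder \<Rightarrow> 'a"
  assumes "strict_mono_on {..<\<beta>} h" "\<xi> < \<beta>"
  shows "\<xi> \<le> h \<xi>"
  using assms(2)
proof (induction \<xi> rule: less_induct)
  case (less \<xi>)
  show ?case
  proof (rule ccontr)
    assume "\<not> \<xi> \<le> h \<xi>"
    then have lt: "h \<xi> < \<xi>"
      by simp
    then have "h \<xi> \<le> h (h \<xi>)"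
      using less by auto
    moreover have "h (h \<xi>) < h \<xi>"
      using assms(1) lt less.prems by (auto simp: strict_mono_on_def)
    ultimately show False
      by simp
  qed
qed

text \<open>If \<open>otp B < \<beta>\<close>, following \<open>h\<close> by an embedding of
  \<open>B\<close> into \<open>otp B\<close> would give a strictly increasing map on
  \<open>\<beta>\<close> that moves the point \<open>otp B\<close> down.\<close>

lemma le_otp:
  fixes B :: "'a::wellorder set"
  assumes "B \<subseteq> {..<\<gamma>}" and h: "strict_mono_on {..<\<beta>} h" "h ` {..<\<beta>} \<subseteq> B"
  shows "\<beta> \<le> otp B"
proof (rule ccontr)
  assume "\<not> \<beta> \<le> otp B"
  then have lt: "otp B < \<beta>"
    by simp
  obtain k where k: "strict_mono_on B k" "k ` B \<subseteq> {..<otp B}"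
    using assms(1) by (rule otp_embedding)
  have "strict_mono_on {..<\<beta>} (k \<circ> h)"
    using h k(1) by (auto simp: strict_mono_on_def image_subset_iff)
  then have "otp B \<le> (k \<circ> h) (otp B)"
    using lt by (rule strict_mono_on_expansive)
  moreover have "(k \<circ> h) (otp B) < otp B"
    using k(2) h(2) lt by auto
  ultimately show False
    by simp
qed

lemma otp_lessThan: "otp {..<\<beta>} = (\<beta> :: 'a::wellorder)"
  by (intro antisym otp_le[where h = id] le_otp[where h = id and \<gamma> = \<beta>])
    (auto simp: strict_mono_on_def)

text \<open>The embedding inverts the collapsing map: \<open>h \<delta>\<close> is the end point of
  the initial segment of order type \<open>\<delta>\<close>.\<close>

lemma embedding_of_le_otp:
  fixes B :: "'a::wellorder set"
  assumes B: "B \<subseteq> {..<\<gamma>}" and "\<beta> \<le> otp B"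
  obtains h where "strict_mono_on {..<\<beta>} h" "h ` {..<\<beta>} \<subseteq> B"
proof -
  have "\<forall>\<delta>\<in>{..<\<beta>}. \<exists>b. b \<in> B \<and> otp (B \<inter> {..<b}) = \<delta>"
    using less_otp_imp_initial[OF B] assms(2) by (metis lessThan_iff less_le_trans)
  then obtain h where h: "\<And>\<delta>. \<delta> < \<beta> \<Longrightarrow> h \<delta> \<in> B \<and> otp (B \<inter> {..<h \<delta>}) = \<delta>"
    unfolding bchoice_iff by auto
  have "strict_mono_on {..<\<beta>} h"
  proof (rule strict_mono_onI)
    fix \<delta> \<epsilon> assume *: "\<delta> \<in> {..<\<beta>}" "\<epsilon> \<in> {..<\<beta>}" "\<delta> < \<epsilon>"
    show "h \<delta> < h \<epsilon>"
    proof (rule ccontr)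
      assume "\<not> h \<delta> < h \<epsilon>"
      then have "h \<epsilon> \<le> h \<delta>"
        by simp
      then have "otp (B \<inter> {..<h \<epsilon>}) \<le> otp (B \<inter> {..<h \<delta>})"
        using strict_mono_onD[OF otp_initial_strict_mono[OF B], of "h \<epsilon>" "h \<delta>"] h[of \<delta>] h[of \<epsilon>] *
        by (cases "h \<epsilon> = h \<delta>") (auto simp: order_le_less)
      with * h show False
        by simp
    qed
  qed
  then show ?thesis
    using that h by blast
qed

section \<open>Regularity of the first two uncountable cardinals\<close>

lemma uncountable_lessThan_omega1: "uncountable {..<omega1 :: 'o::ordinal_universe}"
  unfolding omega1_def using uncountable_successor_exists by (metis (mono_tags, lifting) LeastI)

lemma countable_lessThan_omega1: "\<alpha> < (omega1 :: 'o::ordinal_universe) \<Longrightarrow> countable {..<\<alpha>}"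
  unfolding omega1_def using not_less_Least by blast

lemma omega1_lesspoll_omega2:
  "{..<omega1 :: 'o::ordinal_universe} \<prec> {..<omega2 :: 'o}"
proof -
  obtain \<kappa> \<mu> :: 'o where *: "uncountable {..<\<kappa>}" "{..<\<kappa>} \<prec> {..<\<mu>}"
    using uncountable_successor_exists by blast
  then have "omega1 \<le> \<kappa>"
    using countable_lessThan_omega1[of \<kappa>] by (meson not_le)
  then have "{..<omega1 :: 'o} \<lesssim> {..<\<kappa>}"
    by (intro subset_imp_lepoll) auto
  then have "{..<omega1 :: 'o} \<prec> {..<\<mu>}"
    using *(2) lesspoll_trans1 by blast
  then show ?thesis
    unfolding omega2_def by (rule LeastI)
qed

lemma omega1_less_omega2: "(omega1 :: 'o::ordinal_universe) < omega2"
proof (rule ccontr)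
  assume "\<not> (omega1 :: 'o) < omega2"
  then have "{..<omega2 :: 'o} \<lesssim> {..<omega1 :: 'o}"
    by (intro subset_imp_lepoll) auto
  then show False
    using omega1_lesspoll_omega2[where 'o = 'o] by (auto simp: lesspoll_def dest: lepoll_antisym)
qed

lemma lepoll_iff_ordLeq: "X \<lesssim> Y \<longleftrightarrow> (card_of X, card_of Y) \<in> ordLeq"
  by (metis card_of_ordLeq lepoll_def)

lemma lessThan_lepoll_omega1:
  assumes "\<gamma> < (omega2 :: 'o::ordinal_universe)"
  shows "{..<\<gamma>} \<lesssim> {..<omega1 :: 'o}"
proof -
  have "\<not> {..<omega1 :: 'o} \<prec> {..<\<gamma>}"
    using assms unfolding omega2_def by (rule not_less_Least)
  moreover have "{..<\<gamma>} \<lesssim> {..<omega1 :: 'o} \<or> {..<omega1 :: 'o} \<lesssim> {..<\<gamma>}"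
    unfolding lepoll_iff_ordLeq using ordLeq_total card_of_Well_order by blast
  ultimately show ?thesis
    by (metis eqpoll_imp_lepoll eqpoll_sym lesspoll_def)
qed

text \<open>Regularity of \<open>omega1\<close>: the ordinals up to some member of \<open>X\<close>
  form a countable union of countable sets, and any ordinal of \<open>omega1\<close> left over lies
  above \<open>X\<close>.\<close>

lemma countable_bounded_omega1:
  assumes "countable X" "X \<subseteq> {..<omega1 :: 'o::ordinal_universe}"
  obtains \<beta> where "\<beta> < omega1" "\<And>x. x \<in> X \<Longrightarrow> x < \<beta>"
proof -
  have "countable (\<Union>x\<in>X. insert x {..<x})"
    using assms countable_lessThan_omega1 by auto
  then have "\<not> {..<omega1} \<subseteq> (\<Union>x\<in>X. insert x {..<x})"
    using uncountable_lessThan_omega1 countable_subset by blast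
  then obtain \<beta> where "\<beta> < omega1" "\<beta> \<notin> (\<Union>x\<in>X. insert x {..<x})"
    by blast
  then show ?thesis
    using that[of \<beta>] by force
qed

text \<open>The same argument one cardinal higher, with unions of at most \<open>omega1\<close> many
  sets of size at most \<open>omega1\<close>.\<close>

lemma bounded_omega2:
  assumes "X \<lesssim> {..<omega1 :: 'o}" "X \<subseteq> {..<omega2 :: 'o::ordinal_universe}"
  obtains \<beta> where "\<beta> < omega2" "\<And>x. x \<in> X \<Longrightarrow> x < \<beta>"
proof -
  have inf: "infinite {..<omega1 :: 'o}"
    using uncountable_lessThan_omega1 uncountable_infinite by blast
  have "insert x {..<x} \<lesssim> {..<omega1 :: 'o}" if "x \<in> X" for x
  proof (cases "finite {..<x}")
    case True
    then show ?thesis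
      using inf by (simp add: finite_lepoll_infinite)
  next
    case False
    then have "insert x {..<x} \<lesssim> {..<x}"
      by (simp add: infinite_insert_lepoll)
    then show ?thesis
      using lessThan_lepoll_omega1[of x] that assms(2) lepoll_trans by blast
  qed
  then have "(\<Union>x\<in>X. insert x {..<x}) \<lesssim> {..<omega1 :: 'o}"
    using assms(1) inf unfolding lepoll_iff_ordLeq
    by (intro card_of_UNION_ordLeq_infinite) auto
  then have "\<not> {..<omega2} \<subseteq> (\<Union>x\<in>X. insert x {..<x})"
    using omega1_lesspoll_omega2[where 'o = 'o]
    by (meson lepoll_antisym lepoll_trans lesspoll_def subset_imp_lepoll)
  then obtain \<beta> where "\<beta> < omega2" "\<beta> \<notin> (\<Union>x\<in>X. insert x {..<x})"
    by blast
  then show ?thesis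
    using that[of \<beta>] by force
qed

section \<open>The club filter\<close>

lemma countable_atMost_omega1:
  assumes "\<alpha> < (omega1 :: 'o::ordinal_universe)"
  shows "countable {..\<alpha>}"
proof -
  have "{..\<alpha>} = insert \<alpha> {..<\<alpha>}"
    by auto
  then show ?thesis
    using assms by (simp add: countable_lessThan_omega1)
qed

text \<open>
  Every club contains all closure points of some function; this reduces the intersection and the
  diagonal intersection of clubs to operations on functions.
\<close>

definition closure_points :: "('o \<Rightarrow> 'o) \<Rightarrow> 'o::ordinal_universe set" where
  "closure_points \<phi> = {\<alpha>. \<alpha> < omega1 \<and> {..<\<alpha>} \<noteq> {} \<and> (\<forall>\<xi><\<alpha>. \<phi> \<xi> < \<alpha>)}"

text \<open>For unboundedness, iterate from \<open>\<alpha>\<close> a function \<open>g\<close>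
  whose value at \<open>\<delta>\<close> exceeds \<open>\<delta>\<close> and all
  \<open>\<phi> \<xi>\<close> with \<open>\<xi> \<le> \<delta>\<close>; the supremum of the iterates
  is a closure point of \<open>\<phi>\<close>.\<close>

lemma club_closure_points:
  fixes \<phi> :: "'o \<Rightarrow> 'o::ordinal_universe"
  assumes \<phi>: "\<And>\<xi>. \<xi> < omega1 \<Longrightarrow> \<phi> \<xi> < omega1"
  shows "club (closure_points \<phi>)"
  unfolding club_def
proof (intro conjI allI impI)
  show "closure_points \<phi> \<subseteq> {..<omega1}"
    by (auto simp: closure_points_def)
  fix \<alpha> :: 'o assume \<alpha>: "\<alpha> < omega1"
  have "\<exists>\<delta>'. \<delta>' < omega1 \<and> \<delta> < \<delta>' \<and> (\<forall>\<xi>\<le>\<delta>. \<phi> \<xi> < \<delta>')" if "\<delta> < omega1" for \<delta>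
  proof -
    have "countable (insert \<delta> (\<phi> ` {..\<delta>}))"
      using that by (simp add: countable_atMost_omega1)
    moreover have "insert \<delta> (\<phi> ` {..\<delta>}) \<subseteq> {..<omega1}"
      using that \<phi> by auto
    ultimately obtain \<beta> where "\<beta> < omega1" "\<And>x. x \<in> insert \<delta> (\<phi> ` {..\<delta>}) \<Longrightarrow> x < \<beta>"
      using countable_bounded_omega1 by blast
    then show ?thesis
      by auto
  qed
  then obtain g where g: "\<And>\<delta>. \<delta> < omega1 \<Longrightarrow> g \<delta> < omega1 \<and> \<delta> < g \<delta> \<and> (\<forall>\<xi>\<le>\<delta>. \<phi> \<xi> < g \<delta>)"
    by metis
  define a where "a n = (g ^^ n) \<alpha>" for n
  have a: "a n < omega1" for n
    by (induction n) (auto simp: a_def \<alpha> g)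
  have "countable (range a)" "range a \<subseteq> {..<omega1}"
    using a by auto
  then obtain \<beta>0 where \<beta>0: "\<beta>0 < omega1" "\<And>n. a n < \<beta>0"
    by (rule countable_bounded_omega1) blast
  define \<beta> where "\<beta> = (LEAST \<beta>. \<forall>n. a n < \<beta>)"
  have \<beta>: "a n < \<beta>" for n
    using LeastI[of "\<lambda>\<beta>. \<forall>n. a n < \<beta>" \<beta>0] \<beta>0(2) unfolding \<beta>_def by blast
  have "\<beta> \<le> \<beta>0"
    unfolding \<beta>_def using \<beta>0(2) by (intro Least_le) blast
  have "\<phi> \<xi> < \<beta>" if "\<xi> < \<beta>" for \<xi>
  proof -
    have "\<not> (\<forall>n. a n < \<xi>)"
      using that unfolding \<beta>_def by (rule not_less_Least)
    then obtain n where "\<xi> \<le> a n"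
      by (auto simp: not_less)
    then have "\<phi> \<xi> < a (Suc n)"
      using g[OF a[of n]] by (simp add: a_def)
    then show ?thesis
      using \<beta>[of "Suc n"] by simp
  qed
  moreover have "\<alpha> < \<beta>"
    using \<beta>[of 0] by (simp add: a_def)
  moreover have "\<beta> < omega1"
    using \<open>\<beta> \<le> \<beta>0\<close> \<beta>0(1) by (rule le_less_trans)
  ultimately show "\<exists>\<beta>\<in>closure_points \<phi>. \<alpha> < \<beta>"
    unfolding closure_points_def by blast
next
  fix \<delta> :: 'o
  assume "\<delta> < omega1"
    and "{..<\<delta>} \<noteq> {} \<and> (\<forall>\<alpha><\<delta>. \<exists>\<beta>\<in>closure_points \<phi>. \<alpha> < \<beta> \<and> \<beta> < \<delta>)"
  then show "\<delta> \<in> closure_points \<phi>"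
    unfolding closure_points_def by (force intro: less_trans)
qed

text \<open>Let \<open>\<phi>\<close> pick an element of \<open>C\<close> above its argument. Then
  \<open>C\<close> is unbounded below each closure point of \<open>\<phi>\<close>, so closedness
  puts that point into \<open>C\<close>.\<close>

lemma club_contains_closure_points:
  fixes C :: "'o::ordinal_universe set"
  assumes "club C"
  obtains \<phi> where "\<And>\<xi>. \<xi> < omega1 \<Longrightarrow> \<phi> \<xi> < omega1" "closure_points \<phi> \<subseteq> C"
proof -
  obtain \<phi> where \<phi>: "\<And>\<xi>. \<xi> < omega1 \<Longrightarrow> \<phi> \<xi> \<in> C \<and> \<xi> < \<phi> \<xi>"
    using assms unfolding club_def by metis
  have "\<alpha> \<in> C" if "\<alpha> \<in> closure_points \<phi>" for \<alpha>
  proof -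
    have "\<exists>\<beta>\<in>C. \<xi> < \<beta> \<and> \<beta> < \<alpha>" if "\<xi> < \<alpha>" for \<xi>
      using that \<open>\<alpha> \<in> closure_points \<phi>\<close> \<phi>[of \<xi>] unfolding closure_points_def by auto
    then show ?thesis
      using assms that unfolding club_def closure_points_def by blast
  qed
  moreover have "\<phi> \<xi> < omega1" if "\<xi> < omega1" for \<xi>
    using \<phi>[OF that] assms unfolding club_def by blast
  ultimately show ?thesis
    using that by blast
qed

text \<open>With this filter, \<open>eventually\<close> reads "on a club" and
  \<open>frequently\<close> reads "on a stationary set", which turns the bookkeeping of clubs into
  filter reasoning.\<close>

definition club_filter :: "'o::ordinal_universe filter" where
  "club_filter = Abs_filter (\<lambda>P. \<exists>C. club C \<and> (\<forall>\<alpha>\<in>C. P \<alpha>))"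

lemma contains_club_iff_closure_points:
  "(\<exists>C. club C \<and> (\<forall>\<alpha>\<in>C. P \<alpha>)) \<longleftrightarrow>
    (\<exists>\<phi>. (\<forall>\<xi><omega1. \<phi> \<xi> < omega1) \<and> (\<forall>\<alpha>\<in>closure_points \<phi>. P \<alpha>))"
proof
  assume "\<exists>C. club C \<and> (\<forall>\<alpha>\<in>C. P \<alpha>)"
  then obtain C where "club C" "\<forall>\<alpha>\<in>C. P \<alpha>"
    by blast
  then show "\<exists>\<phi>. (\<forall>\<xi><omega1. \<phi> \<xi> < omega1) \<and> (\<forall>\<alpha>\<in>closure_points \<phi>. P \<alpha>)"
    by (elim club_contains_closure_points) blast
qed (use club_closure_points in blast)

lemma eventually_club_filter:
  "eventually P club_filter \<longleftrightarrow> (\<exists>C. club C \<and> (\<forall>\<alpha>\<in>C. P \<alpha>))"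
  unfolding club_filter_def
proof (rule eventually_Abs_filter)
  show "is_filter (\<lambda>P :: 'a \<Rightarrow> bool. \<exists>C. club C \<and> (\<forall>\<alpha>\<in>C. P \<alpha>))"
  proof
    show "\<exists>C. club C \<and> (\<forall>\<alpha>\<in>C. True)"
      unfolding contains_club_iff_closure_points by (intro exI[of _ id]) auto
  next
    fix P Q :: "'a \<Rightarrow> bool"
    assume "\<exists>C. club C \<and> (\<forall>\<alpha>\<in>C. P \<alpha>)" "\<exists>C. club C \<and> (\<forall>\<alpha>\<in>C. Q \<alpha>)"
    then obtain \<phi> \<psi> where \<phi>: "\<forall>\<xi><omega1. \<phi> \<xi> < omega1" "\<forall>\<alpha>\<in>closure_points \<phi>. P \<alpha>"
      and \<psi>: "\<forall>\<xi><omega1. \<psi> \<xi> < omega1" "\<forall>\<alpha>\<in>closure_points \<psi>. Q \<alpha>"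
      unfolding contains_club_iff_closure_points by blast
    let ?m = "\<lambda>\<xi>. max (\<phi> \<xi>) (\<psi> \<xi>)"
    have "closure_points ?m \<subseteq> closure_points \<phi> \<inter> closure_points \<psi>"
      by (auto simp: closure_points_def)
    moreover have "\<forall>\<xi><omega1. ?m \<xi> < omega1"
      using \<phi>(1) \<psi>(1) by simp
    ultimately show "\<exists>C. club C \<and> (\<forall>\<alpha>\<in>C. P \<alpha> \<and> Q \<alpha>)"
      using \<phi>(2) \<psi>(2) unfolding contains_club_iff_closure_points by (intro exI[of _ ?m]) blast
  qed blast
qed

lemma eventually_club_filter_closure_points:
  "eventually P club_filter \<longleftrightarrow>
    (\<exists>\<phi>. (\<forall>\<xi><omega1. \<phi> \<xi> < omega1) \<and> (\<forall>\<alpha>\<in>closure_points \<phi>. P \<alpha>))"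
  unfolding eventually_club_filter contains_club_iff_closure_points ..

lemma eventually_closed_under:
  assumes "\<And>\<xi>. \<xi> < omega1 \<Longrightarrow> \<phi> \<xi> < omega1"
  shows "eventually (\<lambda>\<alpha>. \<alpha> < omega1 \<and> {..<\<alpha>} \<noteq> {} \<and> (\<forall>\<xi><\<alpha>. \<phi> \<xi> < \<alpha>)) club_filter"
  unfolding eventually_club_filter_closure_points
  using assms by (intro exI[of _ \<phi>]) (auto simp: closure_points_def)

lemma eventually_less_omega1: "eventually (\<lambda>\<alpha> :: 'a::ordinal_universe. \<alpha> < omega1) club_filter"
proof -
  have "eventually (\<lambda>\<alpha> :: 'a. \<alpha> < omega1 \<and> {..<\<alpha>} \<noteq> {} \<and> (\<forall>\<xi><\<alpha>. id \<xi> < \<alpha>)) club_filter"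
    by (rule eventually_closed_under) simp
  then show ?thesis
    by eventually_elim blast
qed

lemma eventually_greater:
  assumes "\<xi> < omega1"
  shows "eventually (\<lambda>\<alpha>. \<xi> < \<alpha>) club_filter"
  using eventually_closed_under[OF assms] by eventually_elim blast

text \<open>Closure under diagonal intersections. The clubs are given by functions
  \<open>\<phi> \<xi>\<close>, and one function \<open>\<Phi>\<close> dominates at
  \<open>\<delta>\<close> all values \<open>\<phi> \<xi> \<zeta>\<close> with \<open>\<xi>\<close>
  and \<open>\<zeta>\<close> up to \<open>\<delta>\<close>. Evaluating \<open>\<Phi>\<close> at
  \<open>max \<xi> \<zeta>\<close> shows that a closure point \<open>\<alpha>\<close> of
  \<open>\<Phi>\<close> is one of every \<open>\<phi> \<xi>\<close> with
  \<open>\<xi> < \<alpha>\<close>.\<close>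

lemma eventually_diagonal:
  fixes P :: "'o::ordinal_universe \<Rightarrow> 'o \<Rightarrow> bool"
  assumes "\<And>\<xi>. \<xi> < omega1 \<Longrightarrow> eventually (P \<xi>) club_filter"
  shows "eventually (\<lambda>\<alpha>. \<forall>\<xi><\<alpha>. P \<xi> \<alpha>) club_filter"
proof -
  obtain \<phi> where \<phi>: "\<And>\<xi> \<zeta>. \<xi> < omega1 \<Longrightarrow> \<zeta> < omega1 \<Longrightarrow> \<phi> \<xi> \<zeta> < omega1"
    and P: "\<And>\<xi> \<alpha>. \<xi> < omega1 \<Longrightarrow> \<alpha> \<in> closure_points (\<phi> \<xi>) \<Longrightarrow> P \<xi> \<alpha>"
    using assms unfolding eventually_club_filter_closure_points by metis
  have "\<exists>\<beta><omega1. \<forall>\<xi>\<le>\<delta>. \<forall>\<zeta>\<le>\<delta>. \<phi> \<xi> \<zeta> < \<beta>" if "\<delta> < omega1" for \<delta>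
  proof -
    let ?X = "(\<lambda>(\<xi>, \<zeta>). \<phi> \<xi> \<zeta>) ` ({..\<delta>} \<times> {..\<delta>})"
    have "countable ?X"
      using that by (simp add: countable_atMost_omega1)
    moreover have "?X \<subseteq> {..<omega1}"
      using that \<phi> by auto
    ultimately obtain \<beta> where "\<beta> < omega1" "\<And>x. x \<in> ?X \<Longrightarrow> x < \<beta>"
      using countable_bounded_omega1 by blast
    then show ?thesis
      by fastforce
  qed
  then obtain \<Phi> where \<Phi>: "\<And>\<delta>. \<delta> < omega1 \<Longrightarrow> \<Phi> \<delta> < omega1 \<and> (\<forall>\<xi>\<le>\<delta>. \<forall>\<zeta>\<le>\<delta>. \<phi> \<xi> \<zeta> < \<Phi> \<delta>)"
    by metis
  have "P \<xi> \<alpha>" if \<alpha>: "\<alpha> < omega1" "{..<\<alpha>} \<noteq> {}" "\<forall>\<xi><\<alpha>. \<Phi> \<xi> < \<alpha>" and \<xi>: "\<xi> < \<alpha>" for \<xi> \<alpha>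
  proof (rule P)
    show "\<xi> < omega1"
      using \<alpha>(1) \<xi> by simp
    have "\<phi> \<xi> \<zeta> < \<alpha>" if "\<zeta> < \<alpha>" for \<zeta>
    proof -
      have "max \<xi> \<zeta> < \<alpha>"
        using \<xi> that by simp
      then have "\<Phi> (max \<xi> \<zeta>) < \<alpha>" "max \<xi> \<zeta> < omega1"
        using \<alpha>(3) less_trans[OF _ \<alpha>(1)] by blast+
      then show ?thesis
        using \<Phi>[of "max \<xi> \<zeta>"] by (meson less_trans max.cobounded1 max.cobounded2)
    qed
    then show "\<alpha> \<in> closure_points (\<phi> \<xi>)"
      using \<alpha> by (simp add: closure_points_def)
  qed
  moreover have "eventually (\<lambda>\<alpha>. \<alpha> < omega1 \<and> {..<\<alpha>} \<noteq> {} \<and> (\<forall>\<xi><\<alpha>. \<Phi> \<xi> < \<alpha>)) club_filter"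
    using \<Phi> by (intro eventually_closed_under) blast
  ultimately show ?thesis
    by (rule_tac eventually_mono) blast+
qed

section \<open>Stationary sets and pressing down\<close>

lemma nonstationary_iff:
  "nonstationary S \<longleftrightarrow> S \<subseteq> {..<omega1} \<and> eventually (\<lambda>\<alpha>. \<alpha> \<notin> S) club_filter"
  unfolding nonstationary_def eventually_club_filter by blast

lemma condition_iff:
  "condition S \<longleftrightarrow> S \<subseteq> {..<omega1} \<and> frequently (\<lambda>\<alpha>. \<alpha> \<in> S) club_filter"
  unfolding condition_def nonstationary_iff frequently_def by blast

lemma nonstationary_Diff_iff:
  assumes "S \<subseteq> {..<omega1}"
  shows "nonstationary (S - X) \<longleftrightarrow> eventually (\<lambda>\<alpha>. \<alpha> \<in> S \<longrightarrow> \<alpha> \<in> X) club_filter"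
  using assms unfolding nonstationary_iff by auto

lemma stronger_iff:
  "stronger S T \<longleftrightarrow> condition S \<and> condition T \<and> eventually (\<lambda>\<alpha>. \<alpha> \<in> S \<longrightarrow> \<alpha> \<in> T) club_filter"
  unfolding stronger_def using nonstationary_Diff_iff[of S T] by (auto simp: condition_def)

text \<open>If all fibres of \<open>r\<close> were nonstationary, the diagonal intersection of clubs
  avoiding them would miss \<open>S\<close>, because each \<open>\<alpha> \<in> S\<close> lies in
  the fibre over \<open>r \<alpha> < \<alpha>\<close>.\<close>

lemma Fodor:
  assumes S: "condition S" and r: "\<And>\<alpha>. \<alpha> \<in> S \<Longrightarrow> r \<alpha> < \<alpha>"
  obtains \<xi> where "\<xi> < omega1" "condition {\<alpha>\<in>S. r \<alpha> = \<xi>}"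
proof (rule ccontr)
  assume "\<not> thesis"
  then have "eventually (\<lambda>\<alpha>. \<alpha> \<notin> {\<alpha>\<in>S. r \<alpha> = \<xi>}) club_filter" if "\<xi> < omega1" for \<xi>
    using S that \<open>\<And>\<xi>. \<xi> < omega1 \<Longrightarrow> condition {\<alpha> \<in> S. r \<alpha> = \<xi>} \<Longrightarrow> thesis\<close>
    unfolding condition_iff frequently_def by blast
  then have "eventually (\<lambda>\<alpha>. \<forall>\<xi><\<alpha>. \<alpha> \<notin> {\<alpha>\<in>S. r \<alpha> = \<xi>}) club_filter"
    by (rule eventually_diagonal)
  then have "eventually (\<lambda>\<alpha>. \<alpha> \<notin> S) club_filter"
    by eventually_elim (use r in auto)
  with S show False
    unfolding condition_iff frequently_def by simp
qed

section \<open>Canonical functions as order types\<close>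

lemma condition_restrict:
  "condition S \<Longrightarrow> eventually (\<lambda>\<alpha>. \<alpha> \<in> S \<longrightarrow> P \<alpha>) club_filter \<Longrightarrow> condition {\<alpha>\<in>S. P \<alpha>}"
  unfolding condition_iff by (auto elim!: frequently_rev_mp eventually_mono)

lemma stronger_refl: "condition S \<Longrightarrow> stronger S S"
  by (simp add: stronger_iff)

lemma stronger_subset: "condition S \<Longrightarrow> condition T \<Longrightarrow> S \<subseteq> T \<Longrightarrow> stronger S T"
  by (simp add: stronger_iff subset_iff)

lemma stronger_eventually:
  assumes "stronger S T" "eventually (\<lambda>\<alpha>. \<alpha> \<in> T \<longrightarrow> P \<alpha>) club_filter"
  shows "eventually (\<lambda>\<alpha>. \<alpha> \<in> S \<longrightarrow> P \<alpha>) club_filter"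
proof -
  have "eventually (\<lambda>\<alpha>. \<alpha> \<in> S \<longrightarrow> \<alpha> \<in> T) club_filter"
    using assms(1) by (simp add: stronger_iff)
  with assms(2) show ?thesis
    by eventually_elim blast
qed

lemma stronger_trans: "stronger S T \<Longrightarrow> stronger T U \<Longrightarrow> stronger S U"
  using stronger_eventually[of S T "\<lambda>\<alpha>. \<alpha> \<in> U"] by (simp add: stronger_iff)

lemma condition_not_eventually_False:
  "condition S \<Longrightarrow> \<not> eventually (\<lambda>\<alpha>. \<alpha> \<in> S \<longrightarrow> False) club_filter"
  by (simp add: condition_iff frequently_def)

lemma condition_nonempty: "condition S \<Longrightarrow> S \<noteq> {}"
  using condition_not_eventually_False by fastforce

lemma nonstationary_Diff_less_iff:
  assumes "condition S"
  shows "nonstationary (S - {\<alpha>. \<alpha> < omega1 \<and> P \<alpha>}) \<longleftrightarrow>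
    eventually (\<lambda>\<alpha>. \<alpha> \<in> S \<longrightarrow> P \<alpha>) club_filter"
proof -
  have S: "S \<subseteq> {..<omega1}"
    using assms by (simp add: condition_iff)
  have "(\<lambda>\<alpha>. \<alpha> \<in> S \<longrightarrow> \<alpha> \<in> {\<alpha>. \<alpha> < omega1 \<and> P \<alpha>}) = (\<lambda>\<alpha>. \<alpha> \<in> S \<longrightarrow> P \<alpha>)"
    using S by auto
  then show ?thesis
    unfolding nonstationary_Diff_iff[OF S] by simp
qed

section \<open>Order types of countable approximations\<close>

text \<open>Only meaningful for \<open>\<gamma> < omega2\<close>, where such an injection exists.\<close>

definition omega1_index :: "'o::ordinal_universe \<Rightarrow> 'o \<Rightarrow> 'o" where
  "omega1_index \<gamma> = (SOME e. inj_on e {..<\<gamma>} \<and> e ` {..<\<gamma>} \<subseteq> {..<omega1})"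

lemma omega1_index:
  assumes "\<gamma> < (omega2 :: 'o::ordinal_universe)"
  shows "inj_on (omega1_index \<gamma>) {..<\<gamma>}" "\<And>\<beta>. \<beta> < \<gamma> \<Longrightarrow> omega1_index \<gamma> \<beta> < omega1"
proof -
  have "\<exists>e. inj_on e {..<\<gamma>} \<and> e ` {..<\<gamma>} \<subseteq> {..<omega1 :: 'o}"
    using lessThan_lepoll_omega1[OF assms] unfolding lepoll_def .
  then have "inj_on (omega1_index \<gamma>) {..<\<gamma>} \<and> omega1_index \<gamma> ` {..<\<gamma>} \<subseteq> {..<omega1}"
    unfolding omega1_index_def by (rule someI_ex)
  then show "inj_on (omega1_index \<gamma>) {..<\<gamma>}" "\<And>\<beta>. \<beta> < \<gamma> \<Longrightarrow> omega1_index \<gamma> \<beta> < omega1"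
    by auto
qed

definition approx :: "'o::ordinal_universe \<Rightarrow> 'o \<Rightarrow> 'o set" where
  "approx \<gamma> \<alpha> = {\<beta>. \<beta> < \<gamma> \<and> omega1_index \<gamma> \<beta> < \<alpha>}"

definition canon :: "'o::ordinal_universe \<Rightarrow> 'o \<Rightarrow> 'o" where
  "canon \<gamma> \<alpha> = otp (approx \<gamma> \<alpha>)"

lemma approx_subset: "approx \<gamma> \<alpha> \<subseteq> {..<\<gamma>}"
  by (auto simp: approx_def)

text \<open>For each \<open>\<xi>\<close>, injectivity leaves at most one \<open>\<delta>\<close>
  with \<open>d \<delta> = \<xi>\<close>, and its value \<open>e \<delta>\<close> is passed by club
  many \<open>\<alpha>\<close>. The diagonal intersection over \<open>\<xi>\<close> gives the
  claim.\<close>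

lemma eventually_index_less_imp:
  fixes d e :: "'o::ordinal_universe \<Rightarrow> 'o"
  assumes d: "inj_on d D" and e: "\<And>\<delta>. \<delta> \<in> D \<Longrightarrow> e \<delta> < omega1"
  shows "eventually (\<lambda>\<alpha>. \<forall>\<delta>\<in>D. d \<delta> < \<alpha> \<longrightarrow> e \<delta> < \<alpha>) club_filter"
proof -
  have "eventually (\<lambda>\<alpha>. \<forall>\<delta>\<in>D. d \<delta> = \<xi> \<longrightarrow> e \<delta> < \<alpha>) club_filter" for \<xi>
  proof (cases "\<xi> \<in> d ` D")
    case True
    then obtain \<delta> where \<delta>: "\<delta> \<in> D" "\<xi> = d \<delta>"
      by blast
    from eventually_greater[OF e[OF \<delta>(1)]] show ?thesis
      by eventually_elim (use d \<delta> in \<open>auto dest: inj_onD\<close>)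
  next
    case False
    then have "\<forall>\<delta>\<in>D. d \<delta> = \<xi> \<longrightarrow> e \<delta> < \<alpha>" for \<alpha>
      by blast
    then show ?thesis
      by simp
  qed
  then have "eventually (\<lambda>\<alpha>. \<forall>\<xi><\<alpha>. \<forall>\<delta>\<in>D. d \<delta> = \<xi> \<longrightarrow> e \<delta> < \<alpha>) club_filter"
    by (intro eventually_diagonal)
  then show ?thesis
    by eventually_elim blast
qed

text \<open>This makes \<open>approx\<close>, and with it \<open>canon\<close>, independent of the
  chosen injection up to a club.\<close>

lemma eventually_index_less_iff:
  fixes d e :: "'o::ordinal_universe \<Rightarrow> 'o"
  assumes "inj_on d D" "\<And>\<delta>. \<delta> \<in> D \<Longrightarrow> d \<delta> < omega1"
    and "inj_on e D" "\<And>\<delta>. \<delta> \<in> D \<Longrightarrow> e \<delta> < omega1"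
  shows "eventually (\<lambda>\<alpha>. \<forall>\<delta>\<in>D. d \<delta> < \<alpha> \<longleftrightarrow> e \<delta> < \<alpha>) club_filter"
proof -
  have "eventually (\<lambda>\<alpha>. \<forall>\<delta>\<in>D. d \<delta> < \<alpha> \<longrightarrow> e \<delta> < \<alpha>) club_filter"
    using assms by (intro eventually_index_less_imp)
  moreover have "eventually (\<lambda>\<alpha>. \<forall>\<delta>\<in>D. e \<delta> < \<alpha> \<longrightarrow> d \<delta> < \<alpha>) club_filter"
    using assms by (intro eventually_index_less_imp)
  ultimately show ?thesis
    by eventually_elim blast
qed

text \<open>The index function of \<open>\<gamma>\<close> restricts to an injection of
  \<open>\<beta>\<close> into \<open>omega1\<close>, which can be exchanged on a club for the one
  chosen for \<open>\<beta>\<close>.\<close>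

lemma approx_initial:
  assumes "\<beta> < \<gamma>" "\<gamma> < (omega2 :: 'o::ordinal_universe)"
  shows "eventually (\<lambda>\<alpha>. \<beta> \<in> approx \<gamma> \<alpha> \<and> approx \<gamma> \<alpha> \<inter> {..<\<beta>} = approx \<beta> \<alpha>) club_filter"
proof -
  have \<beta>: "\<beta> < omega2"
    using assms by (rule less_trans)
  have "eventually (\<lambda>\<alpha>. omega1_index \<gamma> \<beta> < \<alpha>) club_filter"
    using omega1_index(2)[OF assms(2,1)] by (rule eventually_greater)
  moreover have "eventually (\<lambda>\<alpha>. \<forall>\<delta>\<in>{..<\<beta>}. omega1_index \<beta> \<delta> < \<alpha> \<longleftrightarrow> omega1_index \<gamma> \<delta> < \<alpha>) club_filter"
  proof (rule eventually_index_less_iff)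
    show "inj_on (omega1_index \<gamma>) {..<\<beta>}"
      using omega1_index(1)[OF assms(2)] assms(1) by (auto intro: inj_on_subset)
    show "omega1_index \<gamma> \<delta> < omega1" if "\<delta> \<in> {..<\<beta>}" for \<delta>
      using omega1_index(2)[OF assms(2), of \<delta>] that assms(1) less_trans by blast
  qed (use omega1_index[OF \<beta>] in auto)
  ultimately show ?thesis
    by eventually_elim (use assms(1) in \<open>auto simp: approx_def\<close>)
qed

lemma canon_less:
  assumes "\<beta> < \<gamma>" "\<gamma> < (omega2 :: 'o::ordinal_universe)"
  shows "eventually (\<lambda>\<alpha>. canon \<beta> \<alpha> < canon \<gamma> \<alpha>) club_filter"
  using approx_initial[OF assms]
proof eventually_elim
  case (elim \<alpha>)
  then show ?case
    using otp_initial_less[OF approx_subset, of \<beta> \<gamma> \<alpha>] by (simp add: canon_def)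
qed

lemma canon_mono:
  assumes "\<beta> \<le> \<gamma>" "\<gamma> < (omega2 :: 'o::ordinal_universe)"
  shows "eventually (\<lambda>\<alpha>. canon \<beta> \<alpha> \<le> canon \<gamma> \<alpha>) club_filter"
proof (cases "\<beta> = \<gamma>")
  case False
  with assms have "\<beta> < \<gamma>"
    by simp
  from canon_less[OF this assms(2)] show ?thesis
    by eventually_elim simp
qed simp

text \<open>The identity is another injection of \<open>omega1\<close> into itself, and with it the
  approximations are the sets \<open>{..<\<alpha>}\<close>. Hence the identity represents
  \<open>omega1\<close> in the ultrapower.\<close>

lemma canon_omega1: "eventually (\<lambda>\<alpha>. canon omega1 \<alpha> = \<alpha>) (club_filter :: 'o::ordinal_universe filter)"
proof -
  have "eventually (\<lambda>\<alpha>. \<forall>\<delta>\<in>{..<omega1}. omega1_index omega1 \<delta> < \<alpha> \<longleftrightarrow> id \<delta> < \<alpha>) (club_filter :: 'o filter)"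
  proof (rule eventually_index_less_iff)
    show "inj_on (omega1_index omega1) {..<omega1 :: 'o}"
      by (rule omega1_index(1)[OF omega1_less_omega2])
    show "omega1_index omega1 \<delta> < omega1" if "\<delta> \<in> {..<omega1 :: 'o}" for \<delta>
      using that by (simp add: omega1_index(2)[OF omega1_less_omega2])
  qed simp_all
  then show ?thesis
    using eventually_less_omega1
  proof eventually_elim
    case (elim \<alpha>)
    have "omega1_index omega1 \<delta> < \<alpha> \<longleftrightarrow> \<delta> < \<alpha>" if "\<delta> < omega1" for \<delta>
      using elim(1) that by simp
    moreover have "\<delta> < omega1" if "\<delta> < \<alpha>" for \<delta>
      using that elim(2) by (rule less_trans)
    ultimately have "approx omega1 \<alpha> = {..<\<alpha>}"
      unfolding approx_def by blast
    then show ?case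
      by (simp add: canon_def otp_lessThan)
  qed
qed

section \<open>Values in the generic ultrapower\<close>

text \<open>
  The ordinals below \<open>[canon \<gamma>]\<close> in the generic ultrapower are the \<open>[canon \<beta>]\<close> with \<open>\<beta> < \<gamma>\<close>:
  \<open>g \<alpha>\<close> is the order type of an initial segment of \<open>approx \<gamma> \<alpha>\<close>, whose end point has index below
  \<open>\<alpha>\<close> and can be pressed down to a constant.
\<close>

lemma less_canon_imp_canon:
  fixes g :: "'o::ordinal_universe \<Rightarrow> 'o"
  assumes S: "condition S" and \<gamma>: "\<gamma> < omega2" and g: "\<And>\<alpha>. \<alpha> \<in> S \<Longrightarrow> g \<alpha> < canon \<gamma> \<alpha>"
  obtains \<beta> U where "\<beta> < \<gamma>" "stronger U S" "\<And>\<alpha>. \<alpha> \<in> U \<Longrightarrow> g \<alpha> = canon \<beta> \<alpha>"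
proof -
  have "\<exists>b. b \<in> approx \<gamma> \<alpha> \<and> otp (approx \<gamma> \<alpha> \<inter> {..<b}) = g \<alpha>" if "\<alpha> \<in> S" for \<alpha>
    using less_otp_imp_initial[OF approx_subset] g[OF that] unfolding canon_def by blast
  then obtain b where b: "\<And>\<alpha>. \<alpha> \<in> S \<Longrightarrow> b \<alpha> \<in> approx \<gamma> \<alpha> \<and> otp (approx \<gamma> \<alpha> \<inter> {..<b \<alpha>}) = g \<alpha>"
    by metis
  have "omega1_index \<gamma> (b \<alpha>) < \<alpha>" if "\<alpha> \<in> S" for \<alpha>
    using b[OF that] by (simp add: approx_def)
  with S obtain \<xi> where U: "condition {\<alpha>\<in>S. omega1_index \<gamma> (b \<alpha>) = \<xi>}"
    by (rule Fodor)
  let ?U = "{\<alpha>\<in>S. omega1_index \<gamma> (b \<alpha>) = \<xi>}"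
  have "?U \<noteq> {}"
    using U by (rule condition_nonempty)
  then obtain \<alpha>0 where \<alpha>0: "\<alpha>0 \<in> ?U"
    by blast
  define \<beta> where "\<beta> = b \<alpha>0"
  have \<beta>: "\<beta> < \<gamma>"
    using b[of \<alpha>0] \<alpha>0 by (simp add: approx_def \<beta>_def)
  have b_eq: "b \<alpha> = \<beta>" if "\<alpha> \<in> ?U" for \<alpha>
    using inj_onD[OF omega1_index(1)[OF \<gamma>], of "b \<alpha>" \<beta>] b[of \<alpha>] \<beta> that \<alpha>0
    by (auto simp: approx_def \<beta>_def)
  have "eventually (\<lambda>\<alpha>. \<alpha> \<in> ?U \<longrightarrow> g \<alpha> = canon \<beta> \<alpha>) club_filter"
    using approx_initial[OF \<beta> \<gamma>]
  proof eventually_elim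
    case (elim \<alpha>)
    show ?case
    proof
      assume \<alpha>: "\<alpha> \<in> ?U"
      then have "g \<alpha> = otp (approx \<gamma> \<alpha> \<inter> {..<\<beta>})"
        using b[of \<alpha>] b_eq[OF \<alpha>] by simp
      with elim show "g \<alpha> = canon \<beta> \<alpha>"
        by (simp add: canon_def)
    qed
  qed
  then have "condition {\<alpha>\<in>?U. g \<alpha> = canon \<beta> \<alpha>}"
    by (rule condition_restrict[OF U])
  then show ?thesis
    using \<beta> S by (intro that[of \<beta> "{\<alpha>\<in>?U. g \<alpha> = canon \<beta> \<alpha>}"] stronger_subset) auto
qed

text \<open>Induction on \<open>\<gamma>\<close>, for all conditions at once since forcing passes to
  extensions. If \<open>f\<close> agrees with \<open>canon \<gamma>\<close>, pressing down
  identifies everything below \<open>[f]\<close> with some \<open>canon \<beta>\<close>, and each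
  \<open>canon \<beta>\<close> with \<open>\<beta> < \<gamma>\<close> lies below \<open>[f]\<close>.
  If they disagree, \<open>f\<close> is smaller or larger than \<open>canon \<gamma>\<close> on a
  condition.\<close>

lemma ult_is_ord_iff_canon:
  fixes f :: "'o::ordinal_universe \<Rightarrow> 'o"
  assumes "\<gamma> < omega2" "condition S"
  shows "ult_is_ord f \<gamma> S \<longleftrightarrow> eventually (\<lambda>\<alpha>. \<alpha> \<in> S \<longrightarrow> f \<alpha> = canon \<gamma> \<alpha>) club_filter"
  using assms
proof (induction \<gamma> arbitrary: f S rule: less_induct)
  case (less \<gamma>)
  have \<gamma>: "\<gamma> < omega2" and S: "condition S"
    by fact+
  have IH: "ult_is_ord f \<beta> S \<longleftrightarrow> eventually (\<lambda>\<alpha>. \<alpha> \<in> S \<longrightarrow> f \<alpha> = canon \<beta> \<alpha>) club_filter"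
    if "\<beta> < \<gamma>" "stronger S T" for f \<beta> S T
    using less.IH[OF that(1)] that \<gamma> by (meson less_trans stronger_iff)
  \<comment> \<open>The unfolded halves of the forced sentence: every element below
    \<open>[f]\<close> is some \<open>\<beta> < \<gamma>\<close>, and every such
    \<open>\<beta>\<close> occurs below \<open>[f]\<close>.\<close>
  define below where "below \<longleftrightarrow> (\<forall>g T T'. stronger T S \<longrightarrow>
      ult_less g f T \<longrightarrow> stronger T' T \<longrightarrow>
      (\<exists>U. stronger U T' \<and> (\<exists>\<beta><\<gamma>. ult_is_ord g \<beta> U)))"
  define above where "above \<longleftrightarrow> (\<forall>\<beta><\<gamma>. \<forall>T. stronger T S \<longrightarrow>
      (\<exists>U. stronger U T \<and> (\<exists>g. ult_less g f U \<and> ult_is_ord g \<beta> U)))"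
  have ult_less: "ult_less g f T \<longleftrightarrow> eventually (\<lambda>\<alpha>. \<alpha> \<in> T \<longrightarrow> g \<alpha> < f \<alpha>) club_filter"
    if "stronger T T'" for g f :: "'o \<Rightarrow> 'o" and T T'
    using that unfolding ult_less_def f_generic_def
    by (intro nonstationary_Diff_less_iff) (simp add: stronger_iff)
  have "ult_is_ord f \<gamma> S \<longleftrightarrow> below \<and> above"
    unfolding ult_is_ord.simps[of f \<gamma>] f_and_def f_ball_def f_bex_def f_imp_def below_def above_def
    by (rule iffI; elim conjE; intro conjI allI impI ballI; blast)
  also have "\<dots> \<longleftrightarrow> eventually (\<lambda>\<alpha>. \<alpha> \<in> S \<longrightarrow> f \<alpha> = canon \<gamma> \<alpha>) club_filter"
  proof (intro iffI conjI)
    assume f: "eventually (\<lambda>\<alpha>. \<alpha> \<in> S \<longrightarrow> f \<alpha> = canon \<gamma> \<alpha>) club_filter"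
    show below
      unfolding below_def
    proof (intro allI impI)
      fix g T T' assume T: "stronger T S" "stronger T' T" and "ult_less g f T"
      then have "eventually (\<lambda>\<alpha>. \<alpha> \<in> T \<longrightarrow> g \<alpha> < f \<alpha>) club_filter"
        using ult_less[OF T(1)] by simp
      then have "eventually (\<lambda>\<alpha>. \<alpha> \<in> T' \<longrightarrow> g \<alpha> < f \<alpha>) club_filter"
        by (rule stronger_eventually[OF T(2)])
      moreover have "eventually (\<lambda>\<alpha>. \<alpha> \<in> T' \<longrightarrow> f \<alpha> = canon \<gamma> \<alpha>) club_filter"
        using stronger_eventually[OF stronger_trans[OF T(2,1)] f] .
      ultimately have "eventually (\<lambda>\<alpha>. \<alpha> \<in> T' \<longrightarrow> g \<alpha> < canon \<gamma> \<alpha>) club_filter"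
        by eventually_elim auto
      moreover have T': "condition T'"
        using T(2) by (simp add: stronger_iff)
      ultimately have T'': "condition {\<alpha>\<in>T'. g \<alpha> < canon \<gamma> \<alpha>}"
        by (intro condition_restrict)
      then obtain \<beta> U where \<beta>: "\<beta> < \<gamma>" and U: "stronger U {\<alpha>\<in>T'. g \<alpha> < canon \<gamma> \<alpha>}"
        and g: "\<And>\<alpha>. \<alpha> \<in> U \<Longrightarrow> g \<alpha> = canon \<beta> \<alpha>"
        using less_canon_imp_canon[OF T'' \<gamma>, of g] by blast
      have "ult_is_ord g \<beta> U"
        using IH[OF \<beta> U] g by simp
      moreover have "stronger U T'"
        using U stronger_subset[OF T'' T'] by (blast intro: stronger_trans)
      ultimately show "\<exists>U. stronger U T' \<and> (\<exists>\<beta><\<gamma>. ult_is_ord g \<beta> U)"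
        using \<beta> by blast
    qed
    show above
      unfolding above_def
    proof (intro allI impI)
      fix \<beta> T assume \<beta>: "\<beta> < \<gamma>" and T: "stronger T S"
      have "ult_is_ord (canon \<beta>) \<beta> T"
        using IH[OF \<beta> T] by simp
      moreover have "ult_less (canon \<beta>) f T"
        unfolding ult_less[OF T] using canon_less[OF \<beta> \<gamma>] stronger_eventually[OF T f] by eventually_elim auto
      moreover have "stronger T T"
        using T by (simp add: stronger_iff)
      ultimately show "\<exists>U. stronger U T \<and> (\<exists>g. ult_less g f U \<and> ult_is_ord g \<beta> U)"
        by blast
    qed
  next
    assume *: "below \<and> above"
    show "eventually (\<lambda>\<alpha>. \<alpha> \<in> S \<longrightarrow> f \<alpha> = canon \<gamma> \<alpha>) club_filter"
    proof (rule ccontr)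
      assume "\<not> ?thesis"
      then have "frequently (\<lambda>\<alpha>. (\<alpha> \<in> S \<and> f \<alpha> < canon \<gamma> \<alpha>) \<or> (\<alpha> \<in> S \<and> canon \<gamma> \<alpha> < f \<alpha>)) club_filter"
        unfolding frequently_def by (rule contrapos_nn) (auto elim: eventually_mono)
      then consider "frequently (\<lambda>\<alpha>. \<alpha> \<in> S \<and> f \<alpha> < canon \<gamma> \<alpha>) club_filter"
        | "frequently (\<lambda>\<alpha>. \<alpha> \<in> S \<and> canon \<gamma> \<alpha> < f \<alpha>) club_filter"
        unfolding frequently_disj_iff by blast
      then show False
      proof cases
        \<comment> \<open>Pressing down makes \<open>f\<close> equal to some
          \<open>canon \<beta>\<close> on a stronger condition, while \<open>above\<close> yields an
          element below \<open>[f]\<close> that also has value \<open>\<beta>\<close>.\<close>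
        case 1
        let ?T = "{\<alpha>\<in>S. f \<alpha> < canon \<gamma> \<alpha>}"
        have T: "condition ?T"
          using 1 S by (auto simp: condition_iff)
        obtain \<beta> U where \<beta>: "\<beta> < \<gamma>" and U: "stronger U ?T"
          and f: "\<And>\<alpha>. \<alpha> \<in> U \<Longrightarrow> f \<alpha> = canon \<beta> \<alpha>"
          using less_canon_imp_canon[OF T \<gamma>, of f] by blast
        have "stronger U S"
          using U stronger_subset[OF T S] by (blast intro: stronger_trans)
        then obtain U' g where U': "stronger U' U" and g: "ult_is_ord g \<beta> U'"
          and "ult_less g f U'"
          using * \<beta> unfolding above_def by blast
        then have less: "eventually (\<lambda>\<alpha>. \<alpha> \<in> U' \<longrightarrow> g \<alpha> < f \<alpha>) club_filter"
          using ult_less[OF U'] by simp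
        have "eventually (\<lambda>\<alpha>. \<alpha> \<in> U' \<longrightarrow> g \<alpha> = canon \<beta> \<alpha>) club_filter"
          using IH[OF \<beta> U'] g by simp
        moreover have "eventually (\<lambda>\<alpha>. \<alpha> \<in> U' \<longrightarrow> f \<alpha> = canon \<beta> \<alpha>) club_filter"
          using f by (intro stronger_eventually[OF U']) simp
        ultimately have "eventually (\<lambda>\<alpha>. \<alpha> \<in> U' \<longrightarrow> False) club_filter"
          using less by eventually_elim auto
        then show False
          using U' condition_not_eventually_False unfolding stronger_iff by blast
      next
        \<comment> \<open>Here \<open>canon \<gamma>\<close> is itself below \<open>[f]\<close>, so
          \<open>below\<close> makes it agree with a \<open>canon \<beta>\<close> for some
          \<open>\<beta> < \<gamma>\<close>, against \<open>canon_less\<close>.\<close>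
        case 2
        let ?T = "{\<alpha>\<in>S. canon \<gamma> \<alpha> < f \<alpha>}"
        have T: "condition ?T"
          using 2 S by (auto simp: condition_iff)
        have "ult_less (canon \<gamma>) f ?T"
          unfolding ult_less[OF stronger_refl[OF T]] by simp
        then obtain U \<beta> where U: "stronger U ?T" and \<beta>: "\<beta> < \<gamma>" "ult_is_ord (canon \<gamma>) \<beta> U"
          using * stronger_refl[OF T] stronger_subset[OF T S] unfolding below_def by blast
        have "eventually (\<lambda>\<alpha>. \<alpha> \<in> U \<longrightarrow> canon \<gamma> \<alpha> = canon \<beta> \<alpha>) club_filter"
          using IH[OF \<beta>(1) U] \<beta>(2) by simp
        then have "eventually (\<lambda>\<alpha>. \<alpha> \<in> U \<longrightarrow> False) club_filter"
          using canon_less[OF \<beta>(1) \<gamma>] by eventually_elim auto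
        then show False
          using U condition_not_eventually_False unfolding stronger_iff by blast
      qed
    qed
  qed
  finally show ?case .
qed

lemma condition_omega1: "condition {..<omega1}"
proof -
  have "\<not> eventually (\<lambda>_ :: 'a. False) club_filter"
  proof
    assume "eventually (\<lambda>_ :: 'a. False) club_filter"
    then have "club ({} :: 'a set)"
      unfolding eventually_club_filter by auto
    moreover have "\<exists>\<alpha>. \<alpha> < (omega1 :: 'a)"
      using uncountable_lessThan_omega1[where 'o = 'a] by (metis all_not_in_conv countable_empty lessThan_iff)
    ultimately show False
      unfolding club_def by blast
  qed
  moreover have "frequently (\<lambda>\<alpha>. \<alpha> < omega1) (club_filter :: 'a filter) \<longleftrightarrow> \<not> eventually (\<lambda>_ :: 'a. False) club_filter"
    unfolding frequently_def using eventually_less_omega1[where 'a = 'a]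
    by (auto elim: eventually_elim2)
  ultimately show ?thesis
    by (simp add: condition_iff)
qed

text \<open>The identity witnesses the quantifier over \<open>h\<close>. Conversely, any
  \<open>h\<close> forced to have value \<open>omega1\<close> agrees with the identity on the
  condition up to a club, so \<open>f \<circ> h\<close> may be replaced by \<open>f\<close>.\<close>

lemma canonical_function_iff_canon:
  fixes f :: "'o::ordinal_universe \<Rightarrow> 'o"
  assumes \<gamma>: "\<gamma> < omega2"
  shows "canonical_function \<gamma> f \<longleftrightarrow> eventually (\<lambda>\<alpha>. f \<alpha> = canon \<gamma> \<alpha>) club_filter"
proof
  assume f: "eventually (\<lambda>\<alpha>. f \<alpha> = canon \<gamma> \<alpha>) club_filter"
  show "canonical_function \<gamma> f"
    unfolding canonical_function_def j_at_omega1_is_def f_bex_def f_and_def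
  proof (intro allI impI exI conjI bexI)
    fix T :: "'o set" assume T: "stronger T {..<omega1}"
    then have cond: "condition T"
      by (simp add: stronger_iff)
    then show "stronger T T"
      by (rule stronger_refl)
    show "ult_is_ord id omega1 T"
      unfolding ult_is_ord_iff_canon[OF omega1_less_omega2 cond]
      using canon_omega1[where 'o = 'o] by eventually_elim simp
    show "ult_is_ord (f \<circ> id) \<gamma> T"
      unfolding ult_is_ord_iff_canon[OF \<gamma> cond] using f by eventually_elim simp
  qed auto
next
  assume f: "canonical_function \<gamma> f"
  show "eventually (\<lambda>\<alpha>. f \<alpha> = canon \<gamma> \<alpha>) club_filter"
  proof (rule ccontr)
    assume "\<not> ?thesis"
    then have "frequently (\<lambda>\<alpha>. f \<alpha> \<noteq> canon \<gamma> \<alpha>) club_filter"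
      by (simp add: frequently_def)
    moreover have "eventually (\<lambda>\<alpha>. f \<alpha> \<noteq> canon \<gamma> \<alpha> \<longrightarrow> \<alpha> < omega1 \<and> f \<alpha> \<noteq> canon \<gamma> \<alpha>) club_filter"
      using eventually_less_omega1 by eventually_elim simp
    ultimately have "frequently (\<lambda>\<alpha>. \<alpha> < omega1 \<and> f \<alpha> \<noteq> canon \<gamma> \<alpha>) club_filter"
      by (rule frequently_rev_mp)
    then have T: "condition {\<alpha>. \<alpha> < omega1 \<and> f \<alpha> \<noteq> canon \<gamma> \<alpha>}" (is "condition ?T")
      by (auto simp: condition_iff)
    then have "stronger ?T {..<omega1}"
      by (intro stronger_subset condition_omega1) auto
    then obtain U h where U: "stronger U ?T" and h: "ult_is_ord h omega1 U" "ult_is_ord (f \<circ> h) \<gamma> U"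
      using f unfolding canonical_function_def j_at_omega1_is_def f_bex_def f_and_def by blast
    have cond: "condition U"
      using U by (simp add: stronger_iff)
    have "eventually (\<lambda>\<alpha>. \<alpha> \<in> U \<longrightarrow> f \<alpha> \<noteq> canon \<gamma> \<alpha>) club_filter"
      by (rule stronger_eventually[OF U]) simp
    then have "eventually (\<lambda>\<alpha>. \<alpha> \<in> U \<longrightarrow> False) club_filter"
      using h canon_omega1[where 'o = 'o]
      unfolding ult_is_ord_iff_canon[OF omega1_less_omega2 cond] ult_is_ord_iff_canon[OF \<gamma> cond]
      by eventually_elim auto
    with cond show False
      using condition_not_eventually_False by blast
  qed
qed

text \<open>\<open>canon \<gamma>\<close> can stand for every canonical function for
  \<open>\<gamma>\<close>; this removes forcing from the rest of the argument.\<close>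

lemma Bounding_iff_canon:
  "Bounding TYPE('o::ordinal_universe) \<longleftrightarrow>
    (\<forall>F \<in> {..<omega1 :: 'o} \<rightarrow> {..<omega1}.
      \<exists>\<gamma><omega2. eventually (\<lambda>\<alpha>. F \<alpha> \<le> canon \<gamma> \<alpha>) club_filter)"
proof -
  have "(\<exists>f. canonical_function \<gamma> f \<and> (\<exists>C. club C \<and> (\<forall>\<alpha>\<in>C. F \<alpha> \<le> f \<alpha>))) \<longleftrightarrow>
      eventually (\<lambda>\<alpha>. F \<alpha> \<le> canon \<gamma> \<alpha>) club_filter" if \<gamma>: "\<gamma> < omega2" for \<gamma> :: 'o and F
    unfolding canonical_function_iff_canon[OF \<gamma>] eventually_club_filter[symmetric]
  proof
    assume "\<exists>f. eventually (\<lambda>\<alpha>. f \<alpha> = canon \<gamma> \<alpha>) club_filter \<and> eventually (\<lambda>\<alpha>. F \<alpha> \<le> f \<alpha>) club_filter"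
    then obtain f where "eventually (\<lambda>\<alpha>. f \<alpha> = canon \<gamma> \<alpha>) club_filter" "eventually (\<lambda>\<alpha>. F \<alpha> \<le> f \<alpha>) club_filter"
      by blast
    then show "eventually (\<lambda>\<alpha>. F \<alpha> \<le> canon \<gamma> \<alpha>) club_filter"
      by eventually_elim simp
  qed (auto intro!: exI[of _ "canon \<gamma>"])
  then show ?thesis
    unfolding Bounding_def by blast
qed

section \<open>Ranks and branches\<close>

text \<open>The usual rank: each value is the least strict upper bound of the values at the
  predecessors. The hypothesis \<open>bounded\<close> is the instance of regularity that keeps the
  recursion below \<open>\<kappa>\<close>.\<close>

lemma wf_rank:
  fixes R :: "('b \<times> 'b) set" and \<kappa> :: "'o::wellorder"
  assumes "wf R"
    and bounded: "\<And>x h. (\<And>y. (y, x) \<in> R \<Longrightarrow> h y < \<kappa>) \<Longrightarrow> \<exists>\<beta><\<kappa>. \<forall>y. (y, x) \<in> R \<longrightarrow> h y < \<beta>"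
  obtains \<rho> where "\<And>x. \<rho> x < \<kappa>" "\<And>x y. (y, x) \<in> R \<Longrightarrow> \<rho> y < \<rho> x"
proof -
  define \<rho> :: "'b \<Rightarrow> 'o" where "\<rho> = wfrec R (\<lambda>h x. LEAST \<beta>. \<forall>y. (y, x) \<in> R \<longrightarrow> h y < \<beta>)"
  have \<rho>: "\<rho> x = (LEAST \<beta>. \<forall>y. (y, x) \<in> R \<longrightarrow> \<rho> y < \<beta>)" for x
    unfolding \<rho>_def by (subst wfrec[OF \<open>wf R\<close>]) (simp add: cut_apply)
  have "\<rho> x < \<kappa> \<and> (\<forall>y. (y, x) \<in> R \<longrightarrow> \<rho> y < \<rho> x)" for x
    using \<open>wf R\<close>
  proof (induction x rule: wf_induct_rule)
    case (less x)
    then obtain \<beta> where \<beta>: "\<beta> < \<kappa>" "\<forall>y. (y, x) \<in> R \<longrightarrow> \<rho> y < \<beta>"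
      using bounded[of x \<rho>] by blast
    have "\<forall>y. (y, x) \<in> R \<longrightarrow> \<rho> y < \<rho> x"
      unfolding \<rho>[of x] using \<beta>(2) by (rule LeastI)
    moreover have "\<rho> x \<le> \<beta>"
      unfolding \<rho>[of x] using \<beta>(2) by (rule Least_le)
    ultimately show ?case
      using \<beta>(1) by simp
  qed
  then show ?thesis
    using that by blast
qed

section \<open>Finite restrictions and branches of trees\<close>

lemma length_seq_restrict [simp]: "length (seq_restrict x n) = n"
  by (simp add: seq_restrict_def)

lemma nth_seq_restrict [simp]: "i < n \<Longrightarrow> seq_restrict x n ! i = x i"
  by (simp add: seq_restrict_def)

lemma take_seq_restrict [simp]: "take m (seq_restrict x n) = seq_restrict x (min m n)"
  by (rule nth_equalityI) simp_all

lemma seq_restrict_eq_iff: "seq_restrict x n = seq_restrict y n \<longleftrightarrow> (\<forall>i<n. x i = y i)"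
  by (auto simp: seq_restrict_def)

lemma seq_restrict_Suc: "seq_restrict x (Suc n) = seq_restrict x n @ [x n]"
  by (simp add: seq_restrict_def)

lemma map_seq_restrict: "map h (seq_restrict x n) = seq_restrict (h \<circ> x) n"
  by (simp add: seq_restrict_def)

lemma set_seq_restrict: "set (seq_restrict x n) = x ` {..<n}"
  by (simp add: seq_restrict_def atLeast0LessThan)

text \<open>The longer node comes first in the pair, so that a branch is a descending sequence and
  ranks decrease along the tree.\<close>

definition child_rel :: "'k list set \<Rightarrow> ('k list \<times> 'k list) set" where
  "child_rel N = {(v, u). u \<in> N \<and> v \<in> N \<and> (\<exists>k. v = u @ [k])}"

lemma child_relI: "u \<in> N \<Longrightarrow> u @ [k] \<in> N \<Longrightarrow> (u @ [k], u) \<in> child_rel N"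
  by (simp add: child_rel_def)

text \<open>A descending sequence of nodes adds one entry at a time, so its members cohere and
  define a branch. The sequence may start above the root; closure under \<open>take\<close> then
  supplies the missing initial segments.\<close>

lemma wf_child_rel_iff_no_branch:
  assumes take: "\<And>w n. w \<in> N \<Longrightarrow> take n w \<in> N"
  shows "wf (child_rel N) \<longleftrightarrow> \<not> (\<exists>z. \<forall>n. seq_restrict z n \<in> N)"
proof
  assume wf: "wf (child_rel N)"
  show "\<not> (\<exists>z. \<forall>n. seq_restrict z n \<in> N)"
  proof
    assume "\<exists>z. \<forall>n. seq_restrict z n \<in> N"
    then obtain z where z: "\<And>n. seq_restrict z n \<in> N"
      by blast
    have "(seq_restrict z (Suc n), seq_restrict z n) \<in> child_rel N" for n
      unfolding seq_restrict_Suc using z[of n] z[of "Suc n"] by (intro child_relI) (simp_all add: seq_restrict_Suc)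
    then show False
      using wf unfolding wf_iff_no_infinite_down_chain by blast
  qed
next
  assume no: "\<not> (\<exists>z. \<forall>n. seq_restrict z n \<in> N)"
  show "wf (child_rel N)"
    unfolding wf_iff_no_infinite_down_chain
  proof
    assume "\<exists>w. \<forall>n. (w (Suc n), w n) \<in> child_rel N"
    then obtain w where w: "\<And>n. (w (Suc n), w n) \<in> child_rel N"
      by blast
    have prefix: "take (length (w n)) (w (n + m)) = w n" for n m
    proof (induction m)
      case (Suc m)
      obtain k where "w (Suc (n + m)) = w (n + m) @ [k]"
        using w[of "n + m"] by (auto simp: child_rel_def)
      moreover have "length (w n) \<le> length (w (n + m))"
        using arg_cong[OF Suc, of length] by simp
      ultimately show ?case
        using Suc by simp
    qed simp
    have len: "n \<le> length (w n)" for n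
    proof (induction n)
      case (Suc n)
      then show ?case
        using w[of n] by (auto simp: child_rel_def)
    qed simp
    \<comment> \<open>The node \<open>w (Suc i)\<close> has length at least \<open>Suc i\<close>, so
      its entry \<open>i\<close> exists.\<close>
    define z where "z i = w (Suc i) ! i" for i
    have "seq_restrict z n = take n (w n)" for n
    proof (rule nth_equalityI)
      show "length (seq_restrict z n) = length (take n (w n))"
        using len[of n] by simp
      fix i assume "i < length (seq_restrict z n)"
      then have i: "i < n"
        by simp
      have "take (length (w (Suc i))) (w n) = w (Suc i)"
        using prefix[of "Suc i" "n - Suc i"] i by simp
      then have "w (Suc i) ! i = w n ! i"
        using len[of "Suc i"] by (metis Suc_le_eq nth_take)
      then show "seq_restrict z n ! i = take n (w n) ! i"
        using i by (simp add: z_def)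
    qed
    moreover have "take n (w n) \<in> N" for n
      using w[of n] by (intro take) (auto simp: child_rel_def)
    ultimately show False
      using no by metis
  qed
qed

section \<open>Closed sets of pairs of reals\<close>

lemma tendsto_fun_iff:
  fixes f :: "'a \<Rightarrow> 'i \<Rightarrow> 'b::topological_space"
  shows "(f \<longlongrightarrow> l) F \<longleftrightarrow> (\<forall>i. ((\<lambda>a. f a i) \<longlongrightarrow> l i) F)"
proof -
  have "limitin (product_topology (\<lambda>i. euclidean) UNIV) f l F \<longleftrightarrow> (\<forall>i. limitin euclidean (\<lambda>a. f a i) (l i) F)"
    unfolding limitin_componentwise by simp
  then show ?thesis
    by (simp add: euclidean_product_topology)
qed

text \<open>Points of \<open>F\<close> that agree with \<open>(x, y)\<close> on longer and longer
  initial segments converge to it, each coordinate being eventually constant.\<close>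

lemma closed_Baire_product_memI:
  fixes F :: "((nat \<Rightarrow> nat) \<times> (nat \<Rightarrow> nat)) set"
  assumes "closed F"
    and approx: "\<And>n. \<exists>(x', y')\<in>F. seq_restrict x' n = seq_restrict x n \<and> seq_restrict y' n = seq_restrict y n"
  shows "(x, y) \<in> F"
proof -
  obtain a b where ab: "\<And>n. (a n, b n) \<in> F" "\<And>n. \<forall>i<n. a n i = x i" "\<And>n. \<forall>i<n. b n i = y i"
    using approx unfolding seq_restrict_eq_iff by (auto simp: Bex_def) metis
  have lim: "c \<longlonglongrightarrow> z" if "\<And>n. \<forall>i<n. c n i = z i" for c :: "nat \<Rightarrow> nat \<Rightarrow> nat" and z
    unfolding tendsto_fun_iff
  proof
    fix i
    have "eventually (\<lambda>n. c n i = z i) sequentially"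
      using eventually_gt_at_top[of i] by eventually_elim (use that in blast)
    then show "(\<lambda>n. c n i) \<longlonglongrightarrow> z i"
      by (rule tendsto_eventually)
  qed
  have "(\<lambda>n. (a n, b n)) \<longlonglongrightarrow> (x, y)"
    using ab(2,3) by (intro tendsto_Pair lim)
  then show ?thesis
    using assms(1) ab(1) by (intro Lim_in_closed_set[of F "\<lambda>n. (a n, b n)" sequentially]) auto
qed

section \<open>Arithmetical sets are analytic\<close>

text \<open>The base space is arbitrary so that formulas can be treated as sets of pairs of reals
  before the real quantifier is applied.\<close>

definition analytic :: "'a::topological_space set \<Rightarrow> bool" where
  "analytic X \<longleftrightarrow> (\<exists>F :: ('a \<times> (nat \<Rightarrow> nat)) set. closed F \<and> X = fst ` F)"

lemma continuous_on_fst_coordinate: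
  "continuous_on UNIV (\<lambda>p :: ('i \<Rightarrow> 'b::topological_space) \<times> 'c::topological_space. fst p i)"
  by (rule continuous_on_product_then_coordinatewise[OF continuous_on_fst[OF continuous_on_id]])

lemma continuous_on_snd_coordinate:
  "continuous_on UNIV (\<lambda>p :: 'c::topological_space \<times> ('i \<Rightarrow> 'b::topological_space). snd p i)"
  by (rule continuous_on_product_then_coordinatewise[OF continuous_on_snd[OF continuous_on_id]])

lemma closed_vimage_snd:
  fixes F :: "('a::topological_space \<times> (nat \<Rightarrow> nat)) set"
  assumes "closed F"
  shows "closed {p. (fst p, \<lambda>m. snd p (\<pi> m :: nat)) \<in> F}"
proof -
  have "continuous_on UNIV (\<lambda>p :: 'a \<times> (nat \<Rightarrow> nat). (fst p, \<lambda>m. snd p (\<pi> m)))"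
    by (intro continuous_on_Pair continuous_on_fst continuous_on_id
        continuous_on_coordinatewise_then_product continuous_on_snd_coordinate)
  from closed_vimage[OF assms this] show ?thesis
    by (simp add: vimage_def)
qed

lemma analytic_closed:
  assumes "closed (X :: 'a::topological_space set)"
  shows "analytic X"
  unfolding analytic_def
  using assms by (intro exI[of _ "X \<times> UNIV"]) (auto intro: closed_Times)

text \<open>A witness stores the index at 0 and a witness for that index from 1 on.\<close>

lemma analytic_UN:
  fixes X :: "nat \<Rightarrow> 'a::topological_space set"
  assumes "\<And>n. analytic (X n)"
  shows "analytic (\<Union>n. X n)"
proof -
  obtain F where F: "\<And>n. closed (F n)" "\<And>n. X n = fst ` (F n :: ('a \<times> (nat \<Rightarrow> nat)) set)"
    using assms unfolding analytic_def by metis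
  \<comment> \<open>Membership in \<open>F (w 0)\<close> is written as an intersection of closed
    sets, one for each possible value of \<open>w 0\<close>.\<close>
  let ?G = "\<Inter>n. {p. snd p 0 \<in> - {n}} \<union> {p. (fst p, \<lambda>m. snd p (Suc m)) \<in> F n}"
  have "closed {p :: 'a \<times> (nat \<Rightarrow> nat). snd p 0 \<in> - {n}}" for n
  proof -
    have "closed (- {n})"
      by (simp add: closed_Compl open_discrete)
    from closed_vimage[OF this continuous_on_snd_coordinate[of 0]] show ?thesis
      by (simp add: vimage_def)
  qed
  then have "closed ?G"
    using F(1) by (intro closed_INT ballI closed_Un closed_vimage_snd)
  moreover have "(\<Union>n. X n) = fst ` ?G"
  proof (intro subset_antisym subsetI)
    fix x assume "x \<in> (\<Union>n. X n)"
    then obtain n w where "(x, w) \<in> F n"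
      unfolding F(2) by auto
    then have "(x, case_nat n w) \<in> ?G"
      by auto
    then show "x \<in> fst ` ?G"
      by (rule image_eqI[rotated]) simp
  next
    fix x assume "x \<in> fst ` ?G"
    then obtain w where "(x, w) \<in> ?G"
      by force
    then have "(x, \<lambda>m. w (Suc m)) \<in> F (w 0)"
      by auto
    then show "x \<in> (\<Union>n. X n)"
      unfolding F(2) by force
  qed
  ultimately show ?thesis
    unfolding analytic_def by blast
qed

text \<open>One real codes a witness for every index, with \<open>prod_encode\<close> separating
  them.\<close>

lemma analytic_INT:
  fixes X :: "nat \<Rightarrow> 'a::topological_space set"
  assumes "\<And>n. analytic (X n)"
  shows "analytic (\<Inter>n. X n)"
proof -
  obtain F where F: "\<And>n. closed (F n)" "\<And>n. X n = fst ` (F n :: ('a \<times> (nat \<Rightarrow> nat)) set)"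
    using assms unfolding analytic_def by metis
  let ?G = "\<Inter>n. {p. (fst p, \<lambda>m. snd p (prod_encode (n, m))) \<in> F n}"
  have "closed ?G"
    using F(1) by (intro closed_INT ballI closed_vimage_snd)
  moreover have "(\<Inter>n. X n) = fst ` ?G"
  proof (intro subset_antisym subsetI)
    fix x assume "x \<in> (\<Inter>n. X n)"
    then have "\<forall>n. \<exists>w. (x, w) \<in> F n"
      unfolding F(2) by force
    then obtain w where "\<And>n. (x, w n) \<in> F n"
      by metis
    then have "(x, \<lambda>k. w (fst (prod_decode k)) (snd (prod_decode k))) \<in> ?G"
      by auto
    then show "x \<in> fst ` ?G"
      by (rule image_eqI[rotated]) simp
  next
    fix x assume "x \<in> fst ` ?G"
    then show "x \<in> (\<Inter>n. X n)"
      unfolding F(2) by force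
  qed
  ultimately show ?thesis
    unfolding analytic_def by blast
qed

lemma analytic_Un:
  assumes "analytic X" "analytic Y"
  shows "analytic (X \<union> Y)"
proof -
  have "analytic (\<Union>n :: nat. if n = 0 then X else Y)"
    using assms by (intro analytic_UN) simp
  moreover have "(\<Union>n :: nat. if n = 0 then X else Y) = X \<union> Y"
    by (auto split: if_splits intro: exI[of _ "Suc 0"])
  ultimately show ?thesis
    by simp
qed

lemma analytic_Int:
  assumes "analytic X" "analytic Y"
  shows "analytic (X \<inter> Y)"
proof -
  have "analytic (\<Inter>n :: nat. if n = 0 then X else Y)"
    using assms by (intro analytic_INT) simp
  moreover have "(\<Inter>n :: nat. if n = 0 then X else Y) = X \<inter> Y"
    by (auto split: if_splits intro: exI[of _ "Suc 0"])
  ultimately show ?thesis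
    by simp
qed

text \<open>Continuity into the discrete topology, stated without a topology on the value
  type.\<close>

definition locally_constant :: "('a::topological_space \<Rightarrow> 'b) \<Rightarrow> bool" where
  "locally_constant f \<longleftrightarrow> (\<forall>k. open {p. f p = k})"

text \<open>Covers the evaluation of a real at an argument that varies with the point, as in nested
  terms.\<close>

lemma locally_constant_select:
  assumes "locally_constant v" "\<And>m. locally_constant (h m)"
  shows "locally_constant (\<lambda>p. h (v p) p)"
  unfolding locally_constant_def
proof
  fix k
  have "{p. h (v p) p = k} = (\<Union>m. {p. v p = m} \<inter> {p. h m p = k})"
    by auto
  also have "open \<dots>"
    using assms unfolding locally_constant_def by (intro open_UN ballI open_Int) auto
  finally show "open {p. h (v p) p = k}" .
qed

lemma locally_constant_const: "locally_constant (\<lambda>_. c)"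
  by (simp add: locally_constant_def)

lemma locally_constant_comp2:
  assumes "locally_constant v" "locally_constant w"
  shows "locally_constant (\<lambda>p. h (v p) (w p))"
proof -
  have "locally_constant (\<lambda>p. h m (w p))" for m
    using locally_constant_select[OF assms(2) locally_constant_const, of "h m"] by simp
  with assms(1) show ?thesis
    by (rule locally_constant_select)
qed

lemma closed_locally_constant_comp2:
  assumes "locally_constant v" "locally_constant w"
  shows "closed {p. Q (v p) (w p)}"
proof -
  have "open {p. Q (v p) (w p) = False}"
    using locally_constant_comp2[OF assms, of Q] unfolding locally_constant_def by blast
  then show ?thesis
    by (simp add: closed_def Collect_neg_eq)
qed

lemma locally_constant_arith_val:
  "locally_constant (\<lambda>p. arith_val (fst p) (snd p) e t)"
proof (induction t)
  case (RealX t)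
  have "locally_constant (\<lambda>p :: (nat \<Rightarrow> nat) \<times> (nat \<Rightarrow> nat). fst p m)" for m
  proof -
    have "open ((\<lambda>p :: (nat \<Rightarrow> nat) \<times> (nat \<Rightarrow> nat). fst p m) -` {k})" for k
      by (intro open_vimage open_discrete continuous_on_fst_coordinate)
    then show ?thesis
      by (simp add: locally_constant_def vimage_def)
  qed
  then show ?case
    using locally_constant_select[OF RealX, of "\<lambda>m p. fst p m"] by simp
next
  case (RealY t)
  have "locally_constant (\<lambda>p :: (nat \<Rightarrow> nat) \<times> (nat \<Rightarrow> nat). snd p m)" for m
  proof -
    have "open ((\<lambda>p :: (nat \<Rightarrow> nat) \<times> (nat \<Rightarrow> nat). snd p m) -` {k})" for k
      by (intro open_vimage open_discrete continuous_on_snd_coordinate)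
    then show ?thesis
      by (simp add: locally_constant_def vimage_def)
  qed
  then show ?case
    using locally_constant_select[OF RealY, of "\<lambda>m p. snd p m"] by simp
next
  case (Plus s t)
  show ?case
    using locally_constant_comp2[OF Plus, of "(+)"] by simp
next
  case (Times s t)
  show ?case
    using locally_constant_comp2[OF Times, of "(*)"] by simp
qed (simp_all add: locally_constant_const)

text \<open>Analyticity does not pass to complements in general, so the induction carries a set
  together with its complement. Negation swaps the two, and number quantifiers become countable
  unions and intersections.\<close>

lemma analytic_arith_sat:
  "analytic {p. arith_sat (fst p) (snd p) e \<phi>} \<and> analytic {p. \<not> arith_sat (fst p) (snd p) e \<phi>}"
proof (induction \<phi> arbitrary: e)
  case (Equals s t)
  show ?case
    using closed_locally_constant_comp2[OF locally_constant_arith_val locally_constant_arith_val, of "(=)"] closed_locally_constant_comp2[OF locally_constant_arith_val locally_constant_arith_val, of "(\<noteq>)"]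
    by (simp add: analytic_closed)
next
  case (Less s t)
  show ?case
    using closed_locally_constant_comp2[OF locally_constant_arith_val locally_constant_arith_val, of "(<)"] closed_locally_constant_comp2[OF locally_constant_arith_val locally_constant_arith_val, of "(\<ge>)"]
    by (simp add: analytic_closed not_less)
next
  case (Not \<phi>)
  then show ?case
    by simp
next
  case (And \<phi> \<psi>)
  let ?sat = "\<lambda>\<phi>. {p. arith_sat (fst p) (snd p) e \<phi>}"
  let ?unsat = "\<lambda>\<phi>. {p. \<not> arith_sat (fst p) (snd p) e \<phi>}"
  have "?sat (And \<phi> \<psi>) = ?sat \<phi> \<inter> ?sat \<psi>" "?unsat (And \<phi> \<psi>) = ?unsat \<phi> \<union> ?unsat \<psi>"
    by auto
  then show ?case
    using And[of e] by (simp only: analytic_Int analytic_Un)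
next
  case (ExNum i \<phi>)
  have "analytic (\<Union>n. {p. arith_sat (fst p) (snd p) (e(i := n)) \<phi>})"
    "analytic (\<Inter>n. {p. \<not> arith_sat (fst p) (snd p) (e(i := n)) \<phi>})"
    using ExNum by (auto intro: analytic_UN analytic_INT)
  then show ?case
    by (simp add: Collect_ex_eq Collect_all_eq)
qed

text \<open>A counterexample \<open>y\<close> and an analytic witness for it are merged into one
  real, at its even and odd places.\<close>

lemma lightface_imp_boldface_Pi11:
  assumes "lightface_Pi11 A"
  shows "boldface_Pi11 A"
proof -
  obtain \<phi> where A: "A = {x. \<forall>y. arith_sat x y (\<lambda>_. 0) \<phi>}"
    using assms unfolding lightface_Pi11_def by blast
  obtain F :: "(((nat \<Rightarrow> nat) \<times> (nat \<Rightarrow> nat)) \<times> (nat \<Rightarrow> nat)) set" where F: "closed F"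
    and sat: "{p. \<not> arith_sat (fst p) (snd p) (\<lambda>_. 0) \<phi>} = fst ` F"
    using conjunct2[OF analytic_arith_sat[of "\<lambda>_. 0" \<phi>]] unfolding analytic_def by auto
  let ?m = "\<lambda>(x, w). ((x, \<lambda>n. w (2 * n)), \<lambda>n. w (2 * n + 1))"
  have "continuous_on UNIV (?m :: (nat \<Rightarrow> nat) \<times> (nat \<Rightarrow> nat) \<Rightarrow> _)"
    unfolding case_prod_unfold
    by (intro continuous_on_Pair continuous_on_fst continuous_on_id
        continuous_on_coordinatewise_then_product continuous_on_snd_coordinate)
  with F have "closed (?m -` F)"
    by (rule closed_vimage)
  moreover have "- A = fst ` (?m -` F)"
  proof (intro subset_antisym subsetI)
    fix x assume "x \<in> - A"
    then obtain y where "(x, y) \<in> {p. \<not> arith_sat (fst p) (snd p) (\<lambda>_. 0) \<phi>}"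
      unfolding A by auto
    then obtain z where z: "((x, y), z) \<in> F"
      unfolding sat by force
    then have "(x, \<lambda>k. if even k then y (k div 2) else z (k div 2)) \<in> ?m -` F"
      by simp
    then show "x \<in> fst ` (?m -` F)"
      by (rule image_eqI[rotated]) simp
  next
    fix x assume "x \<in> fst ` (?m -` F)"
    then obtain y where "(x, y) \<in> fst ` F"
      by force
    then show "x \<in> - A"
      unfolding A sat[symmetric] by auto
  qed
  ultimately show ?thesis
    unfolding boldface_Pi11_def by blast
qed

section \<open>From Bounding to Suslin Bounding\<close>

text \<open>Regularity of \<open>omega1\<close> is used twice: to keep the ranks countable, and to
  bound the countable set of all ranks.\<close>

lemma wf_rank_omega1:
  fixes R :: "('b::countable \<times> 'b) set"
  assumes "wf R"
  obtains \<rho> :: "'b \<Rightarrow> 'o::ordinal_universe" and \<beta>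
  where "\<beta> < omega1" "\<And>x. \<rho> x < \<beta>" "\<And>x y. (y, x) \<in> R \<Longrightarrow> \<rho> y < \<rho> x"
proof -
  have bounded: "\<exists>\<beta><omega1. \<forall>y. (y, x) \<in> R \<longrightarrow> h y < \<beta>"
    if "\<And>y. (y, x) \<in> R \<Longrightarrow> h y < omega1" for x and h :: "'b \<Rightarrow> 'o"
  proof -
    have "countable (h ` {y. (y, x) \<in> R})" "h ` {y. (y, x) \<in> R} \<subseteq> {..<omega1}"
      using that by auto
    then obtain \<beta> where "\<beta> < omega1" "\<And>z. z \<in> h ` {y. (y, x) \<in> R} \<Longrightarrow> z < \<beta>"
      by (rule countable_bounded_omega1) blast
    then show ?thesis
      by blast
  qed
  obtain \<rho> :: "'b \<Rightarrow> 'o" where \<rho>: "\<And>x. \<rho> x < omega1" "\<And>x y. (y, x) \<in> R \<Longrightarrow> \<rho> y < \<rho> x"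
    using wf_rank[OF assms bounded] by blast
  have "countable (range \<rho>)" "range \<rho> \<subseteq> {..<omega1}"
    using \<rho>(1) by auto
  then obtain \<beta> where "\<beta> < omega1" "\<And>z. z \<in> range \<rho> \<Longrightarrow> z < \<beta>"
    by (rule countable_bounded_omega1) blast
  then show ?thesis
    using that[of \<beta> \<rho>] \<rho>(2) by blast
qed

lemma Bounding_imp_Suslin_Bounding_boldface:
  assumes "Bounding TYPE('o::ordinal_universe)"
  shows "Suslin_Bounding TYPE('o) boldface_Pi11"
  unfolding Suslin_Bounding_def
proof (intro allI impI ballI)
  fix A and f :: "'o \<Rightarrow> nat \<Rightarrow> nat"
  assume "boldface_Pi11 A" and f: "f \<in> {..<omega1} \<rightarrow> A"
  then obtain K :: "((nat \<Rightarrow> nat) \<times> (nat \<Rightarrow> nat)) set" where K: "closed K" "- A = fst ` K"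
    unfolding boldface_Pi11_def by blast
  \<comment> \<open>The section at \<open>x\<close> of the tree of initial segments of
    \<open>K\<close>. As \<open>K\<close> is closed, its branches are the \<open>y\<close> with
    \<open>(x, y) \<in> K\<close>, so it is wellfounded exactly for
    \<open>x \<in> A\<close>.\<close>
  define N where "N x = {u. \<exists>(x', y')\<in>K. seq_restrict x' (length u) = seq_restrict x (length u)
    \<and> seq_restrict y' (length u) = u}" for x
  have N_take: "take n u \<in> N x" if u: "u \<in> N x" for n u x
  proof -
    obtain x' y' where *: "(x', y') \<in> K" "seq_restrict x' (length u) = seq_restrict x (length u)"
      "seq_restrict y' (length u) = u"
      using u by (auto simp: N_def)
    have "seq_restrict y' (min (length u) n) = take n u"
      using arg_cong[OF *(3), of "take n"] by (simp add: min.commute)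
    moreover have "seq_restrict x' (min (length u) n) = seq_restrict x (min (length u) n)"
      using *(2) by (simp add: seq_restrict_eq_iff)
    ultimately show ?thesis
      using *(1) by (auto simp: N_def)
  qed
  have A_iff: "x \<in> A \<longleftrightarrow> wf (child_rel (N x))" for x
  proof -
    have "(\<exists>z. \<forall>n. seq_restrict z n \<in> N x) \<longleftrightarrow> (\<exists>y. (x, y) \<in> K)"
    proof
      assume "\<exists>z. \<forall>n. seq_restrict z n \<in> N x"
      then obtain z where "\<And>n. seq_restrict z n \<in> N x"
        by blast
      then have "(x, z) \<in> K"
        by (intro closed_Baire_product_memI[OF K(1)]) (auto simp: N_def)
      then show "\<exists>y. (x, y) \<in> K"
        by blast
    next
      assume "\<exists>y. (x, y) \<in> K"
      then show "\<exists>z. \<forall>n. seq_restrict z n \<in> N x"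
        by (auto simp: N_def)
    qed
    moreover have "(\<exists>y. (x, y) \<in> K) \<longleftrightarrow> x \<in> - A"
      unfolding K(2) by force
    ultimately show ?thesis
      using wf_child_rel_iff_no_branch[of "N x"] N_take by blast
  qed
  have N_local: "u \<in> N x \<longleftrightarrow> u \<in> N x'" if "\<forall>i<n. x i = x' i" "length u \<le> n" for u x x' n
  proof -
    have "seq_restrict x (length u) = seq_restrict x' (length u)"
      using that by (simp add: seq_restrict_eq_iff)
    then show ?thesis
      by (simp add: N_def)
  qed

  have "\<exists>\<rho> \<beta>. \<beta> < (omega1 :: 'o) \<and> (\<forall>u. \<rho> u < \<beta>) \<and> (\<forall>u v. (v, u) \<in> child_rel (N x) \<longrightarrow> \<rho> v < \<rho> u)"
    if "x \<in> A" for x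
    using wf_rank_omega1[of "child_rel (N x)"] that unfolding A_iff by metis
  then obtain \<rho> :: "(nat \<Rightarrow> nat) \<Rightarrow> nat list \<Rightarrow> 'o" and bnd
    where bnd: "\<And>x. x \<in> A \<Longrightarrow> bnd x < omega1" and \<rho>_bnd: "\<And>x u. x \<in> A \<Longrightarrow> \<rho> x u < bnd x"
      and \<rho>: "\<And>x u v. x \<in> A \<Longrightarrow> (v, u) \<in> child_rel (N x) \<Longrightarrow> \<rho> x v < \<rho> x u"
    by metis

  have "(\<lambda>\<alpha>. bnd (f \<alpha>)) \<in> {..<omega1} \<rightarrow> {..<omega1}"
    using bnd f by auto
  from bspec[OF assms[unfolded Bounding_iff_canon] this]
  obtain \<gamma>0 where \<gamma>0: "\<gamma>0 < omega2" "eventually (\<lambda>\<alpha>. bnd (f \<alpha>) \<le> canon \<gamma>0 \<alpha>) club_filter"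
    by blast
  \<comment> \<open>With \<open>\<gamma>\<close> at least \<open>omega1\<close>, every
    \<open>x \<in> A\<close>, whether or not \<open>f\<close> takes it as a value, has a ranking
    below \<open>\<gamma>\<close>.\<close>
  define \<gamma> where "\<gamma> = max \<gamma>0 omega1"
  have \<gamma>: "\<gamma> < omega2" "omega1 \<le> \<gamma>" "\<gamma>0 \<le> \<gamma>"
    using \<gamma>0(1) omega1_less_omega2 by (auto simp: \<gamma>_def)
  have bounded: "eventually (\<lambda>\<alpha>. bnd (f \<alpha>) \<le> canon \<gamma> \<alpha>) club_filter"
    using \<gamma>0(2) canon_mono[OF \<gamma>(3,1)] by eventually_elim (rule order_trans)
  define e where "e = omega1_index \<gamma>"
  have e: "inj_on e {..<\<gamma>}" "\<And>\<beta>. \<beta> < \<gamma> \<Longrightarrow> e \<beta> < omega1"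
    unfolding e_def using omega1_index[OF \<gamma>(1)] by auto

  \<comment> \<open>Elements of \<open>A\<close> are witnessed by ranks in \<open>\<gamma>\<close>, as in the Shoenfield tree; the injection \<open>e\<close>
    turns them into countable ordinals, and ranks in \<open>approx \<gamma> \<alpha>\<close> into ordinals below \<open>\<alpha>\<close>.\<close>
  define ranking where "ranking x \<sigma> \<longleftrightarrow> (\<forall>n. \<sigma> n < \<gamma>) \<and>
    (\<forall>u v. (v, u) \<in> child_rel (N x) \<longrightarrow> \<sigma> (to_nat v) < \<sigma> (to_nat u))" for x \<sigma>
  define T where "T = {(seq_restrict x n, seq_restrict (e \<circ> \<sigma>) n) | x \<sigma> n. ranking x \<sigma>}"
  have ranking_compose: "ranking x (\<lambda>n. h (\<rho> x (from_nat n)))"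
    if "x \<in> A" "strict_mono_on {..<bnd x} h" "h ` {..<bnd x} \<subseteq> {..<\<gamma>}" for x h
    using that \<rho>_bnd \<rho> unfolding ranking_def by (auto simp: strict_mono_on_def image_subset_iff)
  have branch: "(seq_restrict x n, seq_restrict (e \<circ> \<sigma>) n) \<in> T" if "ranking x \<sigma>" for x \<sigma> n
    using that unfolding T_def by blast

  have tree: "tree_on omega1 T"
    unfolding tree_on_def
  proof (clarify, intro conjI allI)
    fix s t assume "(s, t) \<in> T"
    then obtain x \<sigma> n where *: "s = seq_restrict x n" "t = seq_restrict (e \<circ> \<sigma>) n" "ranking x \<sigma>"
      unfolding T_def by blast
    show "length s = length t"
      using * by simp
    show "set t \<subseteq> {..<omega1}"
      using * e(2) by (auto simp: set_seq_restrict ranking_def)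
    show "(take m s, take m t) \<in> T" for m
      using * branch by simp
  qed

  have "x \<in> A" if x: "x \<in> tree_proj T" for x
  proof -
    obtain y where y: "\<And>n. (seq_restrict x n, seq_restrict y n) \<in> T"
      using x unfolding tree_proj_def by blast
    have approx: "\<exists>x' \<sigma>. ranking x' \<sigma> \<and> (\<forall>i<n. x i = x' i) \<and> (\<forall>i<n. y i = e (\<sigma> i))" for n
    proof -
      obtain x' \<sigma> m where *: "seq_restrict x n = seq_restrict x' m"
        "seq_restrict y n = seq_restrict (e \<circ> \<sigma>) m" "ranking x' \<sigma>"
        using y[of n] unfolding T_def by blast
      moreover have "n = m"
        using arg_cong[OF *(1), of length] by simp
      ultimately show ?thesis
        by (auto simp: seq_restrict_eq_iff)
    qed
    \<comment> \<open>The rankings behind the initial segments of \<open>y\<close> may vary with the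
      length, but injectivity of \<open>e\<close> makes the decoded sequence agree with each of them
      on its segment.\<close>
    let ?\<sigma> = "\<lambda>i. inv_into {..<\<gamma>} e (y i)"
    have "?\<sigma> (to_nat v) < ?\<sigma> (to_nat u)" if vu: "(v, u) \<in> child_rel (N x)" for u v
    proof -
      \<comment> \<open>Large enough to decide whether \<open>u\<close> and \<open>v\<close> are
        nodes of \<open>N x\<close> and to include the positions of their ranks in
        \<open>y\<close>.\<close>
      let ?n = "Suc (max (length v) (max (to_nat u) (to_nat v)))"
      obtain x' \<sigma> where *: "ranking x' \<sigma>" "\<forall>i<?n. x i = x' i" "\<forall>i<?n. y i = e (\<sigma> i)"
        using approx by blast
      have "length u \<le> length v"
        using vu by (auto simp: child_rel_def)
      then have "(v, u) \<in> child_rel (N x')"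
        using vu N_local[OF *(2), of u] N_local[OF *(2), of v] by (auto simp: child_rel_def)
      then have "\<sigma> (to_nat v) < \<sigma> (to_nat u)"
        using *(1) by (simp add: ranking_def)
      moreover have "?\<sigma> i = \<sigma> i" if "i < ?n" for i
        using that *(1,3) e(1) by (simp add: ranking_def)
      ultimately show ?thesis
        by simp
    qed
    then have "child_rel (N x) \<subseteq> inv_image {(a, b). a < b} (\<lambda>u. ?\<sigma> (to_nat u))"
      by auto
    moreover have "wf (inv_image {(a, b). a < b} (\<lambda>u :: nat list. ?\<sigma> (to_nat u)))"
      by (rule wf_inv_image[OF wf])
    ultimately show ?thesis
      unfolding A_iff by (rule wf_subset[rotated])
  qed
  moreover have "x \<in> tree_proj T" if x: "x \<in> A" for x
  proof -
    have "ranking x (\<lambda>n. id (\<rho> x (from_nat n)))"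
      using bnd[OF x] \<gamma>(2) by (intro ranking_compose x) (auto simp: strict_mono_on_def)
    then show ?thesis
      using branch unfolding tree_proj_def by blast
  qed
  ultimately have proj: "A = tree_proj T"
    by blast

  have "eventually (\<lambda>\<alpha>. \<alpha> < omega1 \<and> f \<alpha> \<in> tree_proj (tree_restrict T \<alpha>)) club_filter"
    using bounded eventually_less_omega1
  proof eventually_elim
    case (elim \<alpha>)
    have x: "f \<alpha> \<in> A"
      using f elim(2) by auto
    \<comment> \<open>Moving the ranking of \<open>N (f \<alpha>)\<close> along an embedding into
      \<open>approx \<gamma> \<alpha>\<close> gives every rank an index below
      \<open>\<alpha>\<close>.\<close>
    obtain h where h: "strict_mono_on {..<bnd (f \<alpha>)} h" "h ` {..<bnd (f \<alpha>)} \<subseteq> approx \<gamma> \<alpha>"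
      using elim(1) unfolding canon_def by (rule embedding_of_le_otp[OF approx_subset])
    let ?\<sigma> = "\<lambda>n. h (\<rho> (f \<alpha>) (from_nat n))"
    have "h ` {..<bnd (f \<alpha>)} \<subseteq> {..<\<gamma>}"
      using h(2) approx_subset by (rule order_trans)
    then have "ranking (f \<alpha>) ?\<sigma>"
      by (rule ranking_compose[OF x h(1)])
    moreover have "e (?\<sigma> n) < \<alpha>" for n
      using h(2) \<rho>_bnd[OF x] by (auto simp: approx_def e_def)
    ultimately have "(seq_restrict (f \<alpha>) n, seq_restrict (e \<circ> ?\<sigma>) n) \<in> tree_restrict T \<alpha>" for n
      using branch by (auto simp: tree_restrict_def set_seq_restrict)
    then show ?case
      using elim(2) unfolding tree_proj_def by blast
  qed
  then obtain C where "club C" "C \<subseteq> {\<alpha>. \<alpha> < omega1 \<and> f \<alpha> \<in> tree_proj (tree_restrict T \<alpha>)}"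
    unfolding eventually_club_filter by blast
  with tree proj show "\<exists>T. tree_on omega1 T \<and> A = tree_proj T \<and>
      (\<exists>C. club C \<and> C \<subseteq> {\<alpha>. \<alpha> < omega1 \<and> f \<alpha> \<in> tree_proj (tree_restrict T \<alpha>)})"
    by blast
qed

section \<open>From Suslin Bounding to Bounding\<close>

definition pair_code :: "nat \<Rightarrow> nat \<Rightarrow> nat" where
  "pair_code i j = (i + j) * (i + j) + i"

text \<open>Pairs with sum \<open>s\<close> have codes from \<open>s * s\<close> to below
  \<open>(s + 1) * (s + 1)\<close>, so the code determines the sum, and then
  \<open>i\<close>.\<close>

lemma pair_code_inject: "pair_code i j = pair_code i' j' \<longleftrightarrow> i = i' \<and> j = j'"
proof
  assume eq: "pair_code i j = pair_code i' j'"
  have less: "pair_code a b < pair_code c d" if "a + b < c + d" for a b c d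
  proof -
    have "pair_code a b < Suc (a + b) * Suc (a + b)"
      by (simp add: pair_code_def)
    also have "\<dots> \<le> (c + d) * (c + d)"
      using that by (intro mult_le_mono) auto
    also have "\<dots> \<le> pair_code c d"
      by (simp add: pair_code_def)
    finally show ?thesis .
  qed
  have "i + j = i' + j'"
    using eq less[of i j i' j'] less[of i' j' i j] by linarith
  then show "i = i' \<and> j = j'"
    using eq by (simp add: pair_code_def)
qed simp

definition WF_codes :: "(nat \<Rightarrow> nat) set" where
  "WF_codes = {x. \<forall>y :: nat \<Rightarrow> nat. \<exists>n. x (pair_code (y (n + 1)) (y n)) \<noteq> 0}"

text \<open>The pairing is a polynomial, hence a term of the language; \<open>RealY\<close> supplies
  the would-be descending sequence.\<close>

lemma lightface_Pi11_WF_codes: "lightface_Pi11 WF_codes"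
proof -
  let ?a = "RealY (Plus (NumVar 0) One)" and ?b = "RealY (NumVar 0)"
  let ?p = "Plus (Times (Plus ?a ?b) (Plus ?a ?b)) ?a"
  have "WF_codes = {x. \<forall>y. arith_sat x y (\<lambda>_. 0) (ExNum 0 (Not (Equals (RealX ?p) Zero)))}"
    by (simp add: WF_codes_def pair_code_def)
  then show ?thesis
    unfolding lightface_Pi11_def by blast
qed

text \<open>
  The real coding the copy of \<open>({..<\<beta>}, <)\<close> on \<open>\<nat>\<close> given by \<open>c\<close>, where \<open>x\<close> codes the relation
  holding of \<open>i\<close> and \<open>j\<close> if \<open>x (pair_code i j) = 0\<close>.
\<close>

definition order_code :: "('o \<Rightarrow> nat) \<Rightarrow> 'o::linorder \<Rightarrow> nat \<Rightarrow> nat" where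
  "order_code c \<beta> m = (if \<exists>\<delta> \<epsilon>. \<delta> < \<epsilon> \<and> \<epsilon> < \<beta> \<and> m = pair_code (c \<delta>) (c \<epsilon>) then 0 else 1)"

lemma order_code_eq_0:
  "\<delta> < \<epsilon> \<Longrightarrow> \<epsilon> < \<beta> \<Longrightarrow> order_code c \<beta> (pair_code (c \<delta>) (c \<epsilon>)) = 0"
  by (auto simp: order_code_def)

text \<open>A descending sequence of the coded relation pulls back along the injective
  \<open>c\<close> to a descending sequence of ordinals.\<close>

lemma order_code_in_WF_codes:
  fixes \<beta> :: "'o::wellorder"
  assumes c: "inj_on c {..<\<beta>}"
  shows "order_code c \<beta> \<in> WF_codes"
proof (rule ccontr)
  assume "order_code c \<beta> \<notin> WF_codes"
  then obtain y :: "nat \<Rightarrow> nat" where "\<And>n. order_code c \<beta> (pair_code (y (n + 1)) (y n)) = 0"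
    unfolding WF_codes_def by blast
  then have "\<forall>n. \<exists>\<delta> \<epsilon>. \<delta> < \<epsilon> \<and> \<epsilon> < \<beta> \<and> y (n + 1) = c \<delta> \<and> y n = c \<epsilon>"
    unfolding order_code_def pair_code_inject by (metis zero_neq_one)
  then obtain d e where de: "\<And>n. d n < e n" "\<And>n. e n < \<beta>" "\<And>n. y (n + 1) = c (d n)" "\<And>n. y n = c (e n)"
    by metis
  have "e (Suc n) = d n" for n
    using inj_onD[OF c, of "e (Suc n)" "d n"] de(3)[of n] de(4)[of "Suc n"] de(2)[of "Suc n"]
      less_trans[OF de(1,2)] by simp
  then have "(e (Suc n), e n) \<in> {(x, y). x < y}" for n
    using de(1) by simp
  moreover have "wf {(x, y). x < (y :: 'o)}"
    by (rule wf)
  ultimately show False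
    unfolding wf_iff_no_infinite_down_chain by blast
qed

text \<open>Each node has at most \<open>omega1\<close> children, so regularity of
  \<open>omega2\<close> keeps the ranks below \<open>omega2\<close>; the rank of the root then
  bounds those of all nodes.\<close>

lemma wf_child_rel_rank_omega2:
  fixes N :: "(nat \<times> 'o::ordinal_universe \<times> nat) list set"
  assumes wf: "wf (child_rel N)" and take: "\<And>w n. w \<in> N \<Longrightarrow> take n w \<in> N"
    and N: "\<And>w. w \<in> N \<Longrightarrow> fst ` snd ` set w \<subseteq> {..<omega1}"
  obtains \<rho> and \<gamma> :: 'o where "\<gamma> < omega2" "\<And>w. w \<in> N \<Longrightarrow> \<rho> w < \<gamma>"
    "\<And>u v. (v, u) \<in> child_rel N \<Longrightarrow> \<rho> v < \<rho> u"
proof -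
  have inf: "infinite {..<omega1 :: 'o}"
    using uncountable_lessThan_omega1 uncountable_infinite by blast
  have bounded: "\<exists>\<beta><omega2. \<forall>v. (v, u) \<in> child_rel N \<longrightarrow> h v < \<beta>"
    if h: "\<And>v. (v, u) \<in> child_rel N \<Longrightarrow> h v < omega2" for u and h :: "_ \<Rightarrow> 'o"
  proof -
    \<comment> \<open>The children are split by the two natural numbers in the new entry into
      countably many families, each indexed by \<open>omega1\<close>.\<close>
    define X where "X p = h ` {v. (v, u) \<in> child_rel N \<and>
      (\<exists>\<xi><omega1. v = u @ [(fst p, \<xi>, snd p)])}" for p
    have "X p \<lesssim> {..<omega1 :: 'o}" for p
    proof -
      have "X p \<subseteq> (\<lambda>\<xi>. h (u @ [(fst p, \<xi>, snd p)])) ` {..<omega1}"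
        by (auto simp: X_def)
      then show ?thesis
        by (meson image_lepoll lepoll_trans subset_imp_lepoll)
    qed
    moreover have "(UNIV :: (nat \<times> nat) set) \<lesssim> {..<omega1 :: 'o}"
    proof -
      have "(UNIV :: (nat \<times> nat) set) \<lesssim> (UNIV :: nat set)"
        unfolding lepoll_def by (intro exI[of _ prod_encode]) (simp add: inj_prod_encode)
      moreover have "(UNIV :: nat set) \<lesssim> {..<omega1 :: 'o}"
        using inf by (simp add: infinite_le_lepoll)
      ultimately show ?thesis
        by (rule lepoll_trans)
    qed
    ultimately have "(\<Union>p. X p) \<lesssim> {..<omega1 :: 'o}"
      using inf unfolding lepoll_iff_ordLeq by (intro card_of_UNION_ordLeq_infinite) auto
    moreover have "(\<Union>p. X p) \<subseteq> {..<omega2}"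
      using h by (auto simp: X_def)
    ultimately obtain \<beta> where \<beta>: "\<beta> < omega2" "\<And>z. z \<in> (\<Union>p. X p) \<Longrightarrow> z < \<beta>"
      by (rule bounded_omega2) blast
    have "h v < \<beta>" if v: "(v, u) \<in> child_rel N" for v
    proof (rule \<beta>(2))
      obtain a \<xi> b where eq: "v = u @ [(a, \<xi>, b)]"
        using v by (auto simp: child_rel_def)
      moreover have "\<xi> < omega1"
        using v N[of v] eq by (auto simp: child_rel_def)
      ultimately have "h v \<in> X (a, b)"
        using v by (auto simp: X_def)
      then show "h v \<in> (\<Union>p. X p)"
        by blast
    qed
    then show ?thesis
      using \<beta>(1) by blast
  qed
  obtain \<rho> :: "_ \<Rightarrow> 'o" where \<rho>: "\<And>w. \<rho> w < omega2" "\<And>u v. (v, u) \<in> child_rel N \<Longrightarrow> \<rho> v < \<rho> u"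
    using wf_rank[OF wf bounded] by blast
  have root: "w \<in> N \<Longrightarrow> \<rho> w \<le> \<rho> []" for w
  proof (induction w rule: rev_induct)
    case (snoc k w)
    then have "w \<in> N"
      using take[of "w @ [k]" "length w"] by simp
    then have "\<rho> (w @ [k]) < \<rho> w" "\<rho> w \<le> \<rho> []"
      using \<rho>(2)[OF child_relI] snoc by simp_all
    then show ?case
      by simp
  qed simp
  have "{\<rho> []} \<lesssim> {..<omega1 :: 'o}"
    using inf by (simp add: finite_lepoll_infinite)
  moreover have "{\<rho> []} \<subseteq> {..<omega2}"
    using \<rho>(1) by simp
  ultimately obtain \<gamma> where "\<gamma> < omega2" "\<And>z. z \<in> {\<rho> []} \<Longrightarrow> z < \<gamma>"
    by (rule bounded_omega2) blast
  then show ?thesis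
    using that[of \<gamma> \<rho>] \<rho>(2) le_less_trans[OF root] by blast
qed

text \<open>Only countably many nodes have ordinal entries up to a given
  \<open>\<xi> < omega1\<close>, so the indices of their ranks are bounded below
  \<open>omega1\<close>. The diagonal intersection treats all \<open>\<xi> < \<alpha>\<close>, and a
  nonempty node with entries below \<open>\<alpha>\<close> is caught at its largest entry.\<close>

lemma eventually_rank_in_approx:
  fixes N :: "(nat \<times> 'o::ordinal_universe \<times> nat) list set"
  assumes \<gamma>: "\<gamma> < omega2" and \<rho>: "\<And>w. w \<in> N \<Longrightarrow> \<rho> w < \<gamma>"
  shows "eventually (\<lambda>\<alpha>. \<forall>w\<in>N. w \<noteq> [] \<longrightarrow> fst ` snd ` set w \<subseteq> {..<\<alpha>} \<longrightarrow> \<rho> w \<in> approx \<gamma> \<alpha>) club_filter"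
proof -
  have "eventually (\<lambda>\<alpha>. \<forall>w\<in>N. fst ` snd ` set w \<subseteq> {..\<xi>} \<longrightarrow> \<rho> w \<in> approx \<gamma> \<alpha>) club_filter"
    if "\<xi> < omega1" for \<xi>
  proof -
    let ?W = "{w \<in> N. fst ` snd ` set w \<subseteq> {..\<xi>}}"
    have "countable (lists (UNIV \<times> {..\<xi>} \<times> UNIV) :: (nat \<times> 'o \<times> nat) list set)"
      using countable_atMost_omega1[OF that] by (intro countable_lists countable_SIGMA) auto
    moreover have "?W \<subseteq> lists (UNIV \<times> {..\<xi>} \<times> UNIV)"
      by (force simp: image_subset_iff)
    ultimately have "countable ((\<lambda>w. omega1_index \<gamma> (\<rho> w)) ` ?W)"
      by (meson countable_image countable_subset)
    moreover have "(\<lambda>w. omega1_index \<gamma> (\<rho> w)) ` ?W \<subseteq> {..<omega1}"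
      using omega1_index(2)[OF \<gamma> \<rho>] by auto
    ultimately obtain \<beta> where \<beta>: "\<beta> < omega1"
      "\<And>z. z \<in> (\<lambda>w. omega1_index \<gamma> (\<rho> w)) ` ?W \<Longrightarrow> z < \<beta>"
      by (rule countable_bounded_omega1) blast
    show ?thesis
      using eventually_greater[OF \<beta>(1)]
    proof eventually_elim
      case (elim \<alpha>)
      then have "omega1_index \<gamma> (\<rho> w) < \<alpha>" if "w \<in> ?W" for w
        using \<beta>(2) that by (meson imageI less_trans)
      then show ?case
        using \<rho> by (simp add: approx_def)
    qed
  qed
  then have "eventually (\<lambda>\<alpha>. \<forall>\<xi><\<alpha>. \<forall>w\<in>N. fst ` snd ` set w \<subseteq> {..\<xi>} \<longrightarrow> \<rho> w \<in> approx \<gamma> \<alpha>) club_filter"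
    by (rule eventually_diagonal)
  then show ?thesis
  proof eventually_elim
    case (elim \<alpha>)
    show ?case
    proof (intro ballI impI)
      fix w assume w: "w \<in> N" "w \<noteq> []" "fst ` snd ` set w \<subseteq> {..<\<alpha>}"
      let ?\<xi> = "Max (fst ` snd ` set w)"
      have "?\<xi> \<in> fst ` snd ` set w"
        using w(2) by (intro Max_in) auto
      then have "?\<xi> < \<alpha>"
        using w(3) by blast
      moreover have "z \<le> ?\<xi>" if "z \<in> fst ` snd ` set w" for z
        using that by (intro Max_ge) simp_all
      then have "fst ` snd ` set w \<subseteq> {..?\<xi>}"
        by (simp add: subset_iff)
      ultimately show "\<rho> w \<in> approx \<gamma> \<alpha>"
        using elim w(1) by blast
    qed
  qed
qed

section \<open>Descending sequences along branches of \<open>T\<close>\<close>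

text \<open>
  The Kunen-Martin tree: it searches for a branch \<open>(x, y)\<close> of \<open>T\<close> together with an infinite descending
  sequence in the relation coded by \<open>x\<close>.
\<close>

definition descent_tree :: "(nat list \<times> 'o list) set \<Rightarrow> (nat \<times> 'o \<times> nat) list set" where
  "descent_tree T = {w. (map fst w, map (fst \<circ> snd) w) \<in> T \<and>
     (\<forall>i. Suc i < length w \<longrightarrow>
        (let m = pair_code (snd (snd (w ! Suc i))) (snd (snd (w ! i)))
         in m < length w \<longrightarrow> fst (w ! m) = 0))}"

lemma take_descent_tree:
  assumes "tree_on \<kappa> T" "w \<in> descent_tree T"
  shows "take n w \<in> descent_tree T"
proof -
  have "(take n (map fst w), take n (map (fst \<circ> snd) w)) \<in> T"
    using assms unfolding tree_on_def descent_tree_def by blast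
  then show ?thesis
    using assms(2) unfolding descent_tree_def by (auto simp: take_map Let_def)
qed

text \<open>A branch would produce an element of \<open>WF_codes\<close> and a descending sequence
  in the relation that it codes.\<close>

lemma wf_descent_tree:
  assumes T: "tree_on \<kappa> T" and proj: "tree_proj T \<subseteq> WF_codes"
  shows "wf (child_rel (descent_tree T))"
proof -
  have "False" if z: "\<And>n. seq_restrict z n \<in> descent_tree T" for z
  proof -
    have "(seq_restrict (fst \<circ> z) n, seq_restrict ((fst \<circ> snd) \<circ> z) n) \<in> T" for n
      using z[of n] by (simp add: descent_tree_def map_seq_restrict)
    then have "fst \<circ> z \<in> WF_codes"
      using proj unfolding tree_proj_def by blast
    then obtain n where n: "fst (z (pair_code (snd (snd (z (n + 1)))) (snd (snd (z n))))) \<noteq> 0"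
      unfolding WF_codes_def by (auto dest: spec[of _ "snd \<circ> snd \<circ> z"])
    let ?m = "pair_code (snd (snd (z (n + 1)))) (snd (snd (z n)))"
    have "fst (z ?m) = 0"
      \<comment> \<open>A restriction of this length contains both step \<open>n\<close> and
        position \<open>?m\<close>, so the condition in the tree applies.\<close>
      using z[of "Suc (Suc (max n ?m))"] by (auto simp: descent_tree_def Let_def dest!: spec[of _ n])
    with n show False
      by simp
  qed
  then show ?thesis
    using wf_child_rel_iff_no_branch[of "descent_tree T"] take_descent_tree[OF T] by blast
qed

text \<open>Finite descending sequences below \<open>\<beta>\<close> give nodes along a fixed branch
  of \<open>T\<close> through the code. Sending \<open>\<delta>\<close> to the least rank of such a
  node whose sequence ends in \<open>\<delta>\<close> embeds \<open>\<beta>\<close> into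
  \<open>approx \<gamma> \<alpha>\<close>.\<close>

lemma le_canon_of_descent_tree_rank:
  fixes \<beta> :: "'o::ordinal_universe"
  assumes proj: "order_code c \<beta> \<in> tree_proj (tree_restrict T \<alpha>)"
    and \<rho>: "\<And>u v. (v, u) \<in> child_rel (descent_tree T) \<Longrightarrow> \<rho> v < \<rho> u"
    and range: "\<And>w. w \<in> descent_tree T \<Longrightarrow> w \<noteq> [] \<Longrightarrow> fst ` snd ` set w \<subseteq> {..<\<alpha>} \<Longrightarrow> \<rho> w \<in> approx \<gamma> \<alpha>"
  shows "\<beta> \<le> canon \<gamma> \<alpha>"
proof -
  let ?x = "order_code c \<beta>"
  obtain y where "\<And>n. (seq_restrict ?x n, seq_restrict y n) \<in> tree_restrict T \<alpha>"
    using proj unfolding tree_proj_def by blast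
  then have T: "\<And>n. (seq_restrict ?x n, seq_restrict y n) \<in> T" and y: "\<And>n. set (seq_restrict y n) \<subseteq> {..<\<alpha>}"
    by (auto simp: tree_restrict_def)
  have y: "y i < \<alpha>" for i
    using y[of "Suc i"] by (auto simp: set_seq_restrict)
  define node where "node d = map (\<lambda>i. (?x i, y i, c (d ! i))) [0..<length d]" for d
  define D where "D \<delta> = {d. d \<noteq> [] \<and> last d = \<delta> \<and> set d \<subseteq> {..<\<beta>} \<and> (\<forall>i. Suc i < length d \<longrightarrow> d ! Suc i < d ! i)}" for \<delta>
  have node_mem: "node d \<in> descent_tree T" if d: "d \<in> D \<delta>" for d \<delta>
  proof -
    have "map fst (node d) = seq_restrict ?x (length d)" "map (fst \<circ> snd) (node d) = seq_restrict y (length d)"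
      by (simp_all add: node_def seq_restrict_def)
    moreover have "?x (pair_code (c (d ! Suc i)) (c (d ! i))) = 0" if "Suc i < length d" for i
    proof (rule order_code_eq_0)
      show "d ! Suc i < d ! i"
        using d that by (simp add: D_def)
      have "d ! i \<in> set d"
        using that by simp
      then show "d ! i < \<beta>"
        using d by (auto simp: D_def)
    qed
    ultimately show ?thesis
      using T by (simp add: descent_tree_def Let_def node_def)
  qed
  have node_approx: "\<rho> (node d) \<in> approx \<gamma> \<alpha>" if "d \<in> D \<delta>" for d \<delta>
    using that y by (intro range node_mem) (auto simp: node_def D_def)
  define g where "g \<delta> = (LEAST \<xi>. \<exists>d\<in>D \<delta>. \<xi> = \<rho> (node d))" for \<delta>
  have g: "\<exists>d\<in>D \<delta>. g \<delta> = \<rho> (node d)" if "\<delta> < \<beta>" for \<delta>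
  proof -
    have "[\<delta>] \<in> D \<delta>"
      using that by (simp add: D_def)
    then have "\<exists>\<xi>. \<exists>d\<in>D \<delta>. \<xi> = \<rho> (node d)"
      by blast
    then show ?thesis
      unfolding g_def by (rule LeastI_ex)
  qed
  have "strict_mono_on {..<\<beta>} g"
  proof (rule strict_mono_onI)
    fix \<delta> \<epsilon> assume *: "\<delta> \<in> {..<\<beta>}" "\<epsilon> \<in> {..<\<beta>}" "\<delta> < \<epsilon>"
    obtain d where d: "d \<in> D \<epsilon>" "g \<epsilon> = \<rho> (node d)"
      using g[of \<epsilon>] * by auto
    \<comment> \<open>Appending \<open>\<delta>\<close> to a sequence that realises
      \<open>g \<epsilon>\<close> gives a child node, hence a smaller rank, which bounds
      \<open>g \<delta>\<close> from above.\<close>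
    have "(d @ [\<delta>]) ! Suc i < (d @ [\<delta>]) ! i" if "Suc i < length (d @ [\<delta>])" for i
    proof (cases "Suc i < length d")
      case True
      then show ?thesis
        using d(1) by (simp add: D_def nth_append)
    next
      case False
      then have "i = length d - 1"
        using that by simp
      moreover have "d \<noteq> []" "last d = \<epsilon>"
        using d(1) by (auto simp: D_def)
      ultimately show ?thesis
        using *(3) last_conv_nth[of d] by (simp add: nth_append)
    qed
    then have d': "d @ [\<delta>] \<in> D \<delta>"
      using d(1) * unfolding D_def by simp
    have "node (d @ [\<delta>]) = node d @ [(?x (length d), y (length d), c \<delta>)]"
      by (simp add: node_def nth_append)
    then have "\<rho> (node (d @ [\<delta>])) < \<rho> (node d)"
      using child_relI node_mem[OF d(1)] node_mem[OF d'] by (metis \<rho>)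
    moreover have "g \<delta> \<le> \<rho> (node (d @ [\<delta>]))"
      unfolding g_def using d' by (intro Least_le) blast
    ultimately show "g \<delta> < g \<epsilon>"
      using d(2) by simp
  qed
  moreover have "g ` {..<\<beta>} \<subseteq> approx \<gamma> \<alpha>"
    using g node_approx by fastforce
  ultimately show ?thesis
    unfolding canon_def by (rule le_otp[OF approx_subset])
qed

section \<open>The equivalence of the principles\<close>

lemma Suslin_Bounding_lightface_imp_Bounding:
  assumes "Suslin_Bounding TYPE('o::ordinal_universe) lightface_Pi11"
  shows "Bounding TYPE('o)"
  unfolding Bounding_iff_canon
proof
  fix F :: "'o \<Rightarrow> 'o" assume F: "F \<in> {..<omega1} \<rightarrow> {..<omega1}"
  have "\<exists>c :: 'o \<Rightarrow> nat. inj_on c {..<F \<alpha>}" if "\<alpha> < omega1" for \<alpha>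
    using countable_lessThan_omega1[of "F \<alpha>"] F that unfolding countable_def by blast
  then obtain c :: "'o \<Rightarrow> 'o \<Rightarrow> nat" where c: "\<And>\<alpha>. \<alpha> < omega1 \<Longrightarrow> inj_on (c \<alpha>) {..<F \<alpha>}"
    by metis
  define f where "f \<alpha> = order_code (c \<alpha>) (F \<alpha>)" for \<alpha>
  have "f \<in> {..<omega1} \<rightarrow> WF_codes"
    unfolding f_def by (intro Pi_I order_code_in_WF_codes c) simp
  with assms lightface_Pi11_WF_codes
  have "\<exists>T. tree_on (omega1 :: 'o) T \<and> WF_codes = tree_proj T \<and>
      (\<exists>C. club C \<and> C \<subseteq> {\<alpha>. \<alpha> < omega1 \<and> f \<alpha> \<in> tree_proj (tree_restrict T \<alpha>)})"
    unfolding Suslin_Bounding_def by simp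
  then obtain T C where T: "tree_on (omega1 :: 'o) T" and proj: "WF_codes = tree_proj T"
    and C: "club C" "C \<subseteq> {\<alpha>. \<alpha> < omega1 \<and> f \<alpha> \<in> tree_proj (tree_restrict T \<alpha>)}"
    by blast
  have wf: "wf (child_rel (descent_tree T))"
    using T by (rule wf_descent_tree) (simp add: proj)
  have entries: "fst ` snd ` set w \<subseteq> {..<omega1}" if "w \<in> descent_tree T" for w
  proof -
    have "(map fst w, map (fst \<circ> snd) w) \<in> T"
      using that by (simp add: descent_tree_def)
    then have "set (map (fst \<circ> snd) w) \<subseteq> {..<omega1}"
      using T unfolding tree_on_def by blast
    then show ?thesis
      by (simp add: image_comp)
  qed
  obtain \<rho> and \<gamma> :: 'o where \<gamma>: "\<gamma> < omega2" and \<rho>: "\<And>w. w \<in> descent_tree T \<Longrightarrow> \<rho> w < \<gamma>"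
    "\<And>u v. (v, u) \<in> child_rel (descent_tree T) \<Longrightarrow> \<rho> v < \<rho> u"
    by (rule wf_child_rel_rank_omega2[OF wf take_descent_tree[OF T] entries]) blast+
  have "eventually (\<lambda>\<alpha>. f \<alpha> \<in> tree_proj (tree_restrict T \<alpha>)) club_filter"
    using C unfolding eventually_club_filter by blast
  moreover have "eventually (\<lambda>\<alpha>. \<forall>w\<in>descent_tree T. w \<noteq> [] \<longrightarrow> fst ` snd ` set w \<subseteq> {..<\<alpha>} \<longrightarrow>
      \<rho> w \<in> approx \<gamma> \<alpha>) club_filter"
    using \<gamma> \<rho>(1) by (rule eventually_rank_in_approx)
  ultimately have "eventually (\<lambda>\<alpha>. F \<alpha> \<le> canon \<gamma> \<alpha>) club_filter"
  proof eventually_elim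
    case (elim \<alpha>)
    then show ?case
      unfolding f_def using \<rho>(2) by (intro le_canon_of_descent_tree_rank) auto
  qed
  with \<gamma> show "\<exists>\<gamma><omega2. eventually (\<lambda>\<alpha>. F \<alpha> \<le> canon \<gamma> \<alpha>) club_filter"
    by blast
qed

theorem theorem5p5:
  shows "(Bounding TYPE('o::ordinal_universe) \<longleftrightarrow> Suslin_Bounding TYPE('o) lightface_Pi11) \<and>
         (Bounding TYPE('o) \<longleftrightarrow> Suslin_Bounding TYPE('o) boldface_Pi11)"
proof -
  \<comment> \<open>The implications form a cycle: Bounding gives the boldface version, which
    restricts to lightface sets, and the lightface version gives back Bounding.\<close>
  have "Suslin_Bounding TYPE('o) boldface_Pi11 \<Longrightarrow> Suslin_Bounding TYPE('o) lightface_Pi11"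
    unfolding Suslin_Bounding_def using lightface_imp_boldface_Pi11 by blast
  then show ?thesis
    using Bounding_imp_Suslin_Bounding_boldface[where 'o = 'o]
      Suslin_Bounding_lightface_imp_Bounding[where 'o = 'o] by blast
qed

end
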